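(* Each of the idempotent commutative semirings $\mathbb{Z}_{\max}=(\mathbb{Z}\cup\{-\infty\},\max,+)$, $\bar{\mathbb{Z}}_{\max}=(\mathbb{Z}\cup\{\pm\infty\},\max,+)$, $\mathbb{N}_{\max}=(\mathbb{N}\cup\{-\infty\},\max,+)$, $\bar{\mathbb{N}}_{\max}=(\mathbb{N}\cup\{\pm\infty\},\max,+)$ and $\mathbb{N}_{\min}=(\mathbb{N}\cup\{+\infty\},\min,+)$ has the Presburger property; that is, if $\mathcal{S}$ is any of these semirings, then for every $n$ the subsets of $\mathcal{S}^n$ definable in the first-order logic of $(\mathcal{S},e,\otimes,\preceq)$ are precisely the rational subsets of the monoid $(\mathcal{S}^n,\otimes)$.
   Context: Semirings. A semiring $(\mathcal{S},\oplus,\otimes,\varepsilon,e)$ has a commutative monoid addition $\oplus$ with neutral element $\varepsilon$, a monoid multiplication $\otimes$ with neutral element $e$, multiplication distributes over addition, and $\varepsilon$ is absorbing for $\otimes$. It is idempotent if $x\oplus x=x$ for all $x$; it is then equipped with the natural order $x\preceq y\iff x\oplus y=y$. In the notation $(M,\max,+)$ or $(M,\min,+)$ the first operation is $\oplus$ and the second is $\otimes$; so $e=0$, and $\varepsilon=-\infty$ in the max semirings, $\varepsilon=+\infty$ in the min semirings. In $\bar{\mathbb{Z}}_{\max}$ and $\bar{\mathbb{N}}_{\max}$, $(-\infty)+(+\infty)=(+\infty)+(-\infty)=-\infty$. The natural order is the usual order for the max semirings and the reverse of the usual order for $\mathbb{N}_{\min}$. $\mathbb{N}$ contains $0$. $\mathcal{S}^n$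 is a monoid under the entrywise product $\otimes$. Rational sets. The class of rational subsets of a monoid $(M,\cdot)$ with unit $1_M$ is the least class of subsets of $M$ that contains all finite subsets and is closed under union $U\cup V$, product $U\cdot V=\{u\cdot v\mid u\in U,v\in V\}$, and star $U^*=U^0\cup U\cup U^2\cup\cdots$, where $U^0=\{1_M\}$. First-order logic. The set $\mathcal{P}$ of first-order logic formulas (Presburger formulas) of $(\mathcal{S},e,\otimes,\preceq)$ is the smallest class of formulas such that: (1) for all nonnegative integers $k_i,r_i$ ($1\le i\le n$), $\bigotimes_{i=1}^n x_i^{k_i}\preceq\bigotimes_{j=1}^n x_j^{r_j}$ is in $\mathcal{P}$, with free variables $x_1,\dots,x_n$ (where $x_i^{k}$ is the $k$-fold $\otimes$-product of $x_i$ with itself and $x_i^0=e$); (2)–(4) $\mathcal{P}$ is closed under conjunction, disjunction and negation (free variables being the union of the free variables of the constituents); (5) if $P(x_1,\dots,x_n)\in\mathcal{P}$ has free variables $x_1,\dots,x_n$, then $(\exists x_i)P(x_1,\dots,x_n)\in\mathcal{P}$, with free variables $x_j$, $j\neq i$. Variables range over $\mathcal{S}$. A subset $D\subset\mathcal{S}^n$ is definable in the first-order logic of $(\mathcal{S},e,\otimes,\preceq)$ if there is a formula $P(x_1,\dots,x_n)\in\mathcal{P}$ with $n$ free variables $x_1,\ldots,x_n$ such that $D=\{(x_1,\dots,x_n)\in\mathcal{S}^n\mid P(x_1,\dots,x_n)\text{ is true}\}$. *)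

theory Defs
  imports "HOL-Algebra.Algebra" "HOL-Library.Extended"
begin

section \<open>Idempotent semirings and the natural order\<close>

locale idempotent_comm_semiring = semiring S + comm_monoid S for S (structure) +
  assumes add_idem: "x \<in> carrier S \<Longrightarrow> x \<oplus> x = x"

definition natural_le :: "('a, 'm) ring_scheme \<Rightarrow> 'a \<Rightarrow> 'a \<Rightarrow> bool" where
  "natural_le S x y \<longleftrightarrow> x \<oplus>\<^bsub>S\<^esub> y = y"

section \<open>The five semirings\<close>

text \<open>The addition that \<^theory>\<open>HOL-Library.Extended\<close> provides satisfies
  \<open>-\<infinity> + \<infinity> = \<infinity>\<close>; here \<open>-\<infinity>\<close> has to be absorbing.\<close>

definition ext_plus :: "int extended \<Rightarrow> int extended \<Rightarrow> int extended" where
  "ext_plus x y = (if x = Minf \<or> y = Minf then Minf else x + y)"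

definition max_semiring :: "int extended set \<Rightarrow> int extended ring" where
  "max_semiring A = \<lparr>carrier = A, monoid.mult = ext_plus, one = Fin 0, ring.zero = Minf, ring.add = max\<rparr>"

definition min_semiring :: "int extended set \<Rightarrow> int extended ring" where
  "min_semiring A = \<lparr>carrier = A, monoid.mult = ext_plus, one = Fin 0, ring.zero = Pinf, ring.add = min\<rparr>"

definition Z_max :: "int extended ring" where
  "Z_max = max_semiring (range Fin \<union> {Minf})"

definition Zbar_max :: "int extended ring" where
  "Zbar_max = max_semiring (range Fin \<union> {Minf, Pinf})"

definition N_max :: "int extended ring" where
  "N_max = max_semiring (Fin ` {0..} \<union> {Minf})"

definition Nbar_max :: "int extended ring" where
  "Nbar_max = max_semiring (Fin ` {0..} \<union> {Minf, Pinf})"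

definition N_min :: "int extended ring" where
  "N_min = min_semiring (Fin ` {0..} \<union> {Pinf})"

section \<open>Rational subsets of a monoid\<close>

primrec set_power :: "('a, 'm) monoid_scheme \<Rightarrow> 'a set \<Rightarrow> nat \<Rightarrow> 'a set" where
  "set_power M U 0 = {\<one>\<^bsub>M\<^esub>}"
| "set_power M U (Suc k) = set_power M U k <#>\<^bsub>M\<^esub> U"

definition set_star :: "('a, 'm) monoid_scheme \<Rightarrow> 'a set \<Rightarrow> 'a set" where
  "set_star M U = (\<Union>k. set_power M U k)"

inductive rational :: "('a, 'm) monoid_scheme \<Rightarrow> 'a set \<Rightarrow> bool" for M where
  finite: "finite U \<Longrightarrow> U \<subseteq> carrier M \<Longrightarrow> rational M U"
| union: "rational M U \<Longrightarrow> rational M V \<Longrightarrow> rational M (U \<union> V)"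
| product: "rational M U \<Longrightarrow> rational M V \<Longrightarrow> rational M (U <#>\<^bsub>M\<^esub> V)"
| star: "rational M U \<Longrightarrow> rational M (set_star M U)"

section \<open>First-order logic of a semiring\<close>

text \<open>\<open>Atom n k r\<close> is the formula
  \<open>x\<^sub>1^(k 1) \<otimes> \<dots> \<otimes> x\<^sub>n^(k n) \<preceq> x\<^sub>1^(r 1) \<otimes> \<dots> \<otimes> x\<^sub>n^(r n)\<close>. All of \<open>x\<^sub>1, \<dots>, x\<^sub>n\<close>
  count as free in it, including those whose exponents are both zero.
  \<open>Ex i P\<close> is \<open>(\<exists>x\<^sub>i) P\<close>.\<close>

datatype formula =
    Atom nat "nat \<Rightarrow> nat" "nat \<Rightarrow> nat"
  | Conj formula formula
  | Disj formula formula
  | Neg formula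
  | Ex nat formula

primrec free_vars :: "formula \<Rightarrow> nat set" where
  "free_vars (Atom n k r) = {1..n}"
| "free_vars (Conj P Q) = free_vars P \<union> free_vars Q"
| "free_vars (Disj P Q) = free_vars P \<union> free_vars Q"
| "free_vars (Neg P) = free_vars P"
| "free_vars (Ex i P) = free_vars P - {i}"

primrec holds :: "('a, 'm) ring_scheme \<Rightarrow> formula \<Rightarrow> (nat \<Rightarrow> 'a) \<Rightarrow> bool" where
  "holds S (Atom n k r) x \<longleftrightarrow>
     natural_le S (\<Otimes>\<^bsub>S\<^esub>i\<in>{1..n}. x i [^]\<^bsub>S\<^esub> k i) (\<Otimes>\<^bsub>S\<^esub>i\<in>{1..n}. x i [^]\<^bsub>S\<^esub> r i)"
| "holds S (Conj P Q) x \<longleftrightarrow> holds S P x \<and> holds S Q x"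
| "holds S (Disj P Q) x \<longleftrightarrow> holds S P x \<or> holds S Q x"
| "holds S (Neg P) x \<longleftrightarrow> \<not> holds S P x"
| "holds S (Ex i P) x \<longleftrightarrow> (\<exists>a \<in> carrier S. holds S P (x(i := a)))"

section \<open>The Presburger property\<close>

text \<open>The monoid \<open>(S\<^sup>n, \<otimes>)\<close>. Despite its name, \<^const>\<open>product_group\<close> makes sense for
  arbitrary monoids; its elements are functions that are undefined outside \<open>{1..n}\<close>.\<close>

definition power_monoid :: "('a, 'm) ring_scheme \<Rightarrow> nat \<Rightarrow> (nat \<Rightarrow> 'a) monoid" where
  "power_monoid S n = product_group {1..n} (\<lambda>_. S)"

definition definable :: "('a, 'm) ring_scheme \<Rightarrow> nat \<Rightarrow> (nat \<Rightarrow> 'a) set \<Rightarrow> bool" where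
  "definable S n D \<longleftrightarrow>
     (\<exists>P. free_vars P = {1..n} \<and> D = {x \<in> carrier (power_monoid S n). holds S P x})"

definition presburger_property :: "('a, 'm) ring_scheme \<Rightarrow> bool" where
  "presburger_property S \<longleftrightarrow> (\<forall>n D. definable S n D \<longleftrightarrow> rational (power_monoid S n) D)"

end

theory Submission
  imports Defs
begin

text \<open>
  Infinite elements are separated from finite ones first: an element of \<open>S\<^sup>n\<close> is written as
  \<open>b + s y\<close> with \<open>b\<close> a vector of zeros and infinities, \<open>s\<close> a vector of signs and \<open>y \<in> \<nat>\<^sup>n\<close>.

  Definable sets are rational: for fixed \<open>b\<close> and \<open>s\<close>, the truth of a formula at \<open>b + s y\<close> depends
  only on the signs of finitely many affine forms in \<open>y\<close> and on residues of \<open>y\<close>. This property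
  survives existential quantification by Cooper's argument. Each cell of such a
  partition of \<open>\<nat>\<^sup>n\<close> is stable under a submonoid of \<open>\<nat>\<^sup>n\<close>, and Dickson's lemma makes the cell a
  finitely generated module over a finitely generated monoid.

  Rational sets are definable: in a commutative monoid a rational set is a finite union of sets
  \<open>b F\<^sup>*\<close> with \<open>F\<close> finite, and \<open>b F\<^sup>*\<close> splits according to the subset \<open>J\<close> of \<open>F\<close> that occurs
  with positive exponents. Once \<open>J\<close> is fixed, so are the infinite components, and the finite
  ones satisfy linear equations in the exponents.
\<close>

section \<open>Cells of affine forms and quantifier elimination\<close>

text \<open>The infinite elements are idempotent and absorb finite ones, so neither cancellation nor
  linear arithmetic is available in \<open>S\<close> as a whole; a fixed pattern of infinities
  leaves a question about integers. The signs serve Dickson's lemma, which needs coordinates in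
  \<nat>, whereas the finite elements may be all of \<int>. The invariant carried through
  quantifiers is semantic: signs and residues determine truth. Cooper's argument then only has to
  exhibit a new finite set of forms, and divisibility never has to be a formula.

  The converse is shaped by the poverty of the language: the unit is its only constant, exponents
  are nonnegative, and quantifiers also reach the infinite elements. Finiteness, each infinity and
  \<open>Fin 1\<close> are therefore defined first. An integer constant becomes the coefficient of a
  variable held at \<open>Fin 1\<close>, negative coefficients move across the inequality, and
  unknown exponents become quantified elements of \<open>S\<close> constrained to be finite and at
  least \<open>Fin 1\<close>.\<close>

definition affine_form :: "'i set \<Rightarrow> (('i \<Rightarrow> int) \<Rightarrow> int) \<Rightarrow> bool" where
  "affine_form V f \<longleftrightarrow> (\<exists>a c. \<forall>y. f y = c + (\<Sum>i\<in>V. a i * y i))"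

lemma affine_form_const: "affine_form V (\<lambda>_. c)"
  unfolding affine_form_def by (intro exI[of _ "\<lambda>_. 0"] exI[of _ c]) simp

lemma affine_form_sum: "affine_form V (\<lambda>y. \<Sum>i\<in>V. a i * y i)"
  unfolding affine_form_def by (intro exI[of _ a] exI[of _ 0]) simp

lemma affine_form_proj:
  assumes "finite V" "i \<in> V"
  shows "affine_form V (\<lambda>y. y i)"
proof -
  have "(\<Sum>j\<in>V. (if j = i then 1 else 0) * y j) = y i" for y :: "'a \<Rightarrow> int"
    using assms by (simp add: if_distrib[of "\<lambda>x. x * _"] cong: if_cong)
  then show ?thesis
    using affine_form_sum[of V "\<lambda>j. if j = i then 1 else 0"] by simp
qed

lemma affine_form_add:
  assumes "affine_form V f" "affine_form V g"
  shows "affine_form V (\<lambda>y. f y + g y)"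
proof -
  obtain a c b d where "\<And>y. f y = c + (\<Sum>i\<in>V. a i * y i)" "\<And>y. g y = d + (\<Sum>i\<in>V. b i * y i)"
    using assms unfolding affine_form_def by metis
  then have "f y + g y = (c + d) + (\<Sum>i\<in>V. (a i + b i) * y i)" for y
    by (simp add: sum.distrib ring_distribs)
  then show ?thesis
    unfolding affine_form_def by (intro exI[of _ "\<lambda>i. a i + b i"] exI[of _ "c + d"]) simp
qed

lemma affine_form_cmult:
  assumes "affine_form V f"
  shows "affine_form V (\<lambda>y. k * f y)"
proof -
  obtain a c where "\<And>y. f y = c + (\<Sum>i\<in>V. a i * y i)"
    using assms unfolding affine_form_def by metis
  then have "k * f y = k * c + (\<Sum>i\<in>V. (k * a i) * y i)" for y
    by (simp add: sum_distrib_left ring_distribs mult.assoc)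
  then show ?thesis
    unfolding affine_form_def by (intro exI[of _ "\<lambda>i. k * a i"] exI[of _ "k * c"]) simp
qed

lemma affine_form_diff:
  assumes "affine_form V f" "affine_form V g"
  shows "affine_form V (\<lambda>y. f y - g y)"
proof -
  have "affine_form V (\<lambda>y. f y + (-1) * g y)"
    by (intro affine_form_add affine_form_cmult assms)
  then show ?thesis by simp
qed

lemma affine_form_mono:
  assumes "affine_form V f" "V \<subseteq> W" "finite W"
  shows "affine_form W f"
proof -
  obtain a c where f: "\<And>y. f y = c + (\<Sum>i\<in>V. a i * y i)"
    using assms(1) unfolding affine_form_def by metis
  have "(\<Sum>i\<in>W. (if i \<in> V then a i else 0) * y i) = (\<Sum>i\<in>V. a i * y i)" for y
    using assms(2,3) by (intro sum.mono_neutral_cong_right) auto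
  then have "f y = c + (\<Sum>i\<in>W. (if i \<in> V then a i else 0) * y i)" for y
    by (simp add: f)
  then show ?thesis
    unfolding affine_form_def by (intro exI[of _ "\<lambda>i. if i \<in> V then a i else 0"] exI[of _ c]) simp
qed

text \<open>A form minus its value at 0 is additive, so translating by \<open>y\<close> changes
  \<open>f\<close> by an amount that does not depend on \<open>x\<close>.\<close>

lemma affine_form_plus_arg:
  assumes "affine_form V f"
  shows "f (\<lambda>i. x i + y i) = f x + (f y - f (\<lambda>_. 0))"
proof -
  obtain a c where "\<And>y. f y = c + (\<Sum>i\<in>V. a i * y i)"
    using assms unfolding affine_form_def by metis
  then show ?thesis
    by (simp add: sum.distrib ring_distribs)
qed

text \<open>The coefficients are integers, so residues of the arguments determine that of the value.
  In \<open>cellular_ex\<close> this makes the bounds on the quantified variable congruent at two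
  points of one cell.\<close>

lemma affine_form_dvd_diff:
  assumes "affine_form V f" "\<And>i. i \<in> V \<Longrightarrow> m dvd x i - y i"
  shows "m dvd f x - f y"
proof -
  obtain a c where f: "\<And>y. f y = c + (\<Sum>i\<in>V. a i * y i)"
    using assms(1) unfolding affine_form_def by metis
  have "f x - f y = (\<Sum>i\<in>V. a i * (x i - y i))"
    by (simp add: f sum_subtractf right_diff_distrib)
  then show ?thesis
    using assms(2) by (simp add: dvd_sum)
qed

text \<open>Splits off the variable to be eliminated: its coefficient \<open>k\<close> is the same
  for all \<open>y\<close>, and the remainder is again a form.\<close>

lemma affine_form_upd:
  assumes "affine_form V f" "finite V" "i \<in> V"
  shows "(\<exists>k. \<forall>y z. f (y(i := z)) = k * z + f (y(i := 0))) \<and> affine_form V (\<lambda>y. f (y(i := 0)))"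
proof -
  obtain a c where f: "\<And>y. f y = c + (\<Sum>i\<in>V. a i * y i)"
    using assms unfolding affine_form_def by metis
  have u: "f (y(i := z)) = c + a i * z + (\<Sum>j\<in>V - {i}. a j * y j)" for y z
    using assms(2,3) by (simp add: f sum.remove[of V i])
  have "affine_form (V - {i}) (\<lambda>y. c + (\<Sum>j\<in>V - {i}. a j * y j))"
    unfolding affine_form_def by blast
  then have "affine_form V (\<lambda>y. c + (\<Sum>j\<in>V - {i}. a j * y j))"
    by (rule affine_form_mono) (use assms(2) in auto)
  then show ?thesis
    by (intro conjI exI[of _ "a i"]) (simp_all add: u)
qed

section \<open>Predicates determined by signs and residues\<close>

text \<open>The semantic counterpart of quantifier-free Presburger formulas. One implication
  suffices, because the hypotheses are symmetric in \<open>y\<close> and \<open>y'\<close>. Indices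
  outside \<open>V\<close> are unconstrained, so \<open>P\<close> cannot depend on them.\<close>

definition cellular :: "(('i \<Rightarrow> int) \<Rightarrow> bool) \<Rightarrow> bool" where
  "cellular P \<longleftrightarrow> (\<exists>V T D. finite V \<and> finite T \<and> D > 0 \<and> (\<forall>f\<in>T. affine_form V f) \<and>
     (\<forall>y y'. (\<forall>f\<in>T. sgn (f y) = sgn (f y')) \<longrightarrow> (\<forall>i\<in>V. D dvd y i - y' i) \<longrightarrow> P y \<longrightarrow> P y'))"

lemma cellularI:
  assumes "finite V" "finite T" "D > 0" "\<And>f. f \<in> T \<Longrightarrow> affine_form V f"
    and "\<And>y y'. \<lbrakk>\<And>f. f \<in> T \<Longrightarrow> sgn (f y) = sgn (f y'); \<And>i. i \<in> V \<Longrightarrow> D dvd y i - y' i; P y\<rbrakk> \<Longrightarrow> P y'"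
  shows "cellular P"
  unfolding cellular_def by (rule exI[of _ V], rule exI[of _ T], rule exI[of _ D]) (use assms in blast)

text \<open>Enlarging \<open>V\<close> only strengthens the hypotheses on \<open>y\<close> and
  \<open>y'\<close>. The set \<open>W\<close> serves to give two predicates nested variable sets, or
  to get a quantified variable into \<open>V\<close>.\<close>

lemma cellularE:
  assumes "cellular P" "finite W"
  obtains V T D where "finite V" "W \<subseteq> V" "finite T" "D > 0" "\<forall>f\<in>T. affine_form V f"
    "\<forall>y y'. (\<forall>f\<in>T. sgn (f y) = sgn (f y')) \<longrightarrow> (\<forall>i\<in>V. D dvd y i - y' i) \<longrightarrow> P y \<longrightarrow> P y'"
proof -
  obtain V T D where 1: "finite V" "finite T" "D > 0" "\<forall>f\<in>T. affine_form V f"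
    "\<forall>y y'. (\<forall>f\<in>T. sgn (f y) = sgn (f y')) \<longrightarrow> (\<forall>i\<in>V. D dvd y i - y' i) \<longrightarrow> P y \<longrightarrow> P y'"
    using assms(1) unfolding cellular_def by blast
  show thesis
  proof (rule that[of "V \<union> W" T D])
    show "\<forall>f\<in>T. affine_form (V \<union> W) f"
      using affine_form_mono[of V _ "V \<union> W"] 1 assms(2) by blast
    show "\<forall>y y'. (\<forall>f\<in>T. sgn (f y) = sgn (f y')) \<longrightarrow> (\<forall>i\<in>V \<union> W. D dvd y i - y' i) \<longrightarrow> P y \<longrightarrow> P y'"
      using 1(5) by blast
  qed (use 1 assms(2) in auto)
qed

lemma cellular_const: "cellular (\<lambda>_. b)"
  by (rule cellularI[of "{}" "{}" 1]) auto

lemma cellular_le_zero: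
  assumes "affine_form V f" "finite V"
  shows "cellular (\<lambda>y. f y \<le> 0)"
proof (rule cellularI[of V "{f}" 1])
  show "f y' \<le> 0" if s: "\<And>g. g \<in> {f} \<Longrightarrow> sgn (g y) = sgn (g y')" and "f y \<le> 0" for y y'
    using s[of f] that(2) by (simp add: sgn_if split: if_splits)
qed (use assms in simp_all)

lemma cellular_not:
  assumes "cellular P"
  shows "cellular (\<lambda>y. \<not> P y)"
proof -
  obtain V T D where *: "finite V" "{} \<subseteq> V" "finite T" "D > 0" "\<forall>f\<in>T. affine_form V f"
    "\<forall>y y'. (\<forall>f\<in>T. sgn (f y) = sgn (f y')) \<longrightarrow> (\<forall>i\<in>V. D dvd y i - y' i) \<longrightarrow> P y \<longrightarrow> P y'"
    by (rule cellularE[OF assms finite.emptyI])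
  show ?thesis
  proof (rule cellularI[OF *(1,3,4)])
    fix y y' assume s: "\<And>f. f \<in> T \<Longrightarrow> sgn (f y) = sgn (f y')"
      and d: "\<And>i. i \<in> V \<Longrightarrow> D dvd y i - y' i" and "\<not> P y"
    moreover have "D dvd y' i - y i" if "i \<in> V" for i
      using d[OF that] by (simp add: dvd_diff_commute)
    ultimately show "\<not> P y'"
      using *(6) by metis
  qed (use *(5) in blast)
qed

lemma cellular_conj:
  assumes "cellular P" "cellular Q"
  shows "cellular (\<lambda>y. P y \<and> Q y)"
proof -
  obtain V T D where 1: "finite V" "{} \<subseteq> V" "finite T" "D > 0" "\<forall>f\<in>T. affine_form V f"
    "\<forall>y y'. (\<forall>f\<in>T. sgn (f y) = sgn (f y')) \<longrightarrow> (\<forall>i\<in>V. D dvd y i - y' i) \<longrightarrow> P y \<longrightarrow> P y'"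
    by (rule cellularE[OF assms(1) finite.emptyI])
  obtain V' T' D' where 2: "finite V'" "V \<subseteq> V'" "finite T'" "D' > 0" "\<forall>f\<in>T'. affine_form V' f"
    "\<forall>y y'. (\<forall>f\<in>T'. sgn (f y) = sgn (f y')) \<longrightarrow> (\<forall>i\<in>V'. D' dvd y i - y' i) \<longrightarrow> Q y \<longrightarrow> Q y'"
    by (rule cellularE[OF assms(2) 1(1)])
  \<comment> \<open>Each predicate tolerates a finer partition; \<open>D * D'\<close> is a common
    multiple of the two moduli.\<close>
  show ?thesis
  proof (rule cellularI[of V' "T \<union> T'" "D * D'"])
    show "affine_form V' f" if "f \<in> T \<union> T'" for f
      using that 1(5) 2(5) affine_form_mono[OF _ 2(2,1)] by blast
    fix y y' assume s: "\<And>f. f \<in> T \<union> T' \<Longrightarrow> sgn (f y) = sgn (f y')"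
      and d: "\<And>i. i \<in> V' \<Longrightarrow> D * D' dvd y i - y' i" and y: "P y \<and> Q y"
    have "D dvd y i - y' i" "D' dvd y i - y' i" if "i \<in> V'" for i
      using d[OF that] by (blast dest: dvd_mult_left dvd_mult_right)+
    then show "P y' \<and> Q y'"
      using 1(6)[rule_format, of y y'] 2(6)[rule_format, of y y'] s y 2(2) by blast
  qed (use 1 2 in auto)
qed

lemma cellular_disj:
  assumes "cellular P" "cellular Q"
  shows "cellular (\<lambda>y. P y \<or> Q y)"
  using cellular_not[OF cellular_conj[OF assms[THEN cellular_not]]] by simp

lemma cellular_ball:
  assumes "finite A" "\<And>a. a \<in> A \<Longrightarrow> cellular (P a)"
  shows "cellular (\<lambda>y. \<forall>a\<in>A. P a y)"
  using assms by (induction A) (auto simp: cellular_const cellular_conj)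

lemma cellular_bex:
  assumes "finite A" "\<And>a. a \<in> A \<Longrightarrow> cellular (P a)"
  shows "cellular (\<lambda>y. \<exists>a\<in>A. P a y)"
  using assms by (induction A) (auto simp: cellular_const cellular_disj)

text \<open>The key to Cooper's quantifier elimination: without leaving its cell with respect to
  the points of \<open>A\<close> or its residue class, \<open>p\<close> can be moved close to a point of \<open>A\<close>.\<close>

lemma shift_near_finite_set:
  fixes p m :: int
  assumes "finite A" "A \<noteq> {}" "m > 0"
  obtains a s where "a \<in> A" "s \<in> {-m..m}" "m dvd a + s - p" "\<And>b. b \<in> A \<Longrightarrow> sgn (p - b) = sgn (a + s - b)"
proof (cases "\<exists>a\<in>A. a \<le> p")
  case True
  define a where "a = Max {a\<in>A. a \<le> p}"
  have "finite {a\<in>A. a \<le> p}" "{a\<in>A. a \<le> p} \<noteq> {}"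
    using assms True by auto
  then have a: "a \<in> A" "a \<le> p" "\<And>b. b \<in> A \<Longrightarrow> b \<le> p \<Longrightarrow> b \<le> a"
    unfolding a_def using Max_in by (fastforce intro: Max_ge)+
  show thesis
  proof (cases "a = p")
    case True
    then show thesis
      using a assms(3) by (intro that[of a 0]) auto
  next
    case False
    \<comment> \<open>The representative of \<open>p - a\<close> modulo \<open>m\<close> in
      \<open>{1..m}\<close>, not \<open>{0..m-1}\<close>: \<open>a + s\<close> has to stay strictly
      above \<open>a\<close>, as \<open>p\<close> does. It does not exceed \<open>p\<close>, and no
      point of \<open>A\<close> lies above \<open>a\<close> and at or below \<open>p\<close>, so no
      sign changes.\<close>
    define s where "s = (p - a - 1) mod m + 1"
    have s: "1 \<le> s" "s \<le> m" "s \<le> p - a"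
      using pos_mod_bound[OF assms(3), of "p - a - 1"] pos_mod_sign[OF assms(3), of "p - a - 1"]
        zmod_le_nonneg_dividend[of "p - a - 1" m] a(2) False
      unfolding s_def by linarith+
    have "a + s - p = - ((p - a - 1) - (p - a - 1) mod m)"
      by (simp add: s_def)
    then have "m dvd a + s - p"
      by (simp only: dvd_minus_iff dvd_minus_mod)
    moreover have "sgn (p - b) = sgn (a + s - b)" if "b \<in> A" for b
      using a(3)[OF that] s a(2) by (cases "b \<le> p") (auto simp: sgn_if)
    ultimately show thesis
      using a s by (intro that[of a s]) auto
  qed
next
  case False
  \<comment> \<open>Here \<open>p\<close> lies below all of \<open>A\<close>: step down from the
    smallest point instead.\<close>
  define a where "a = Min A"
  have a: "a \<in> A" "a > p" "\<And>b. b \<in> A \<Longrightarrow> a \<le> b"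
    unfolding a_def using assms False Min_in[of A] by (auto simp: not_le)
  define s where "s = (a - p - 1) mod m + 1"
  have s: "1 \<le> s" "s \<le> m" "s \<le> a - p"
    using pos_mod_bound[OF assms(3), of "a - p - 1"] pos_mod_sign[OF assms(3), of "a - p - 1"]
      zmod_le_nonneg_dividend[of "a - p - 1" m] a(2)
    unfolding s_def by linarith+
  have "a + - s - p = (a - p - 1) - (a - p - 1) mod m"
    by (simp add: s_def)
  then have "m dvd a + - s - p"
    by (simp only: dvd_minus_mod)
  moreover have "sgn (p - b) = sgn (a + - s - b)" if "b \<in> A" for b
    using a(3)[OF that] s a(2) by (auto simp: sgn_if)
  ultimately show thesis
    using a s by (intro that[of a "-s"]) auto
qed

text \<open>Only the residue of \<open>z\<close> and its position among the zeros of the forms in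
  \<open>z\<close> matter. Scaling by a common multiple \<open>L\<close> of the coefficients makes
  these zeros integer forms \<open>h f\<close>. A witness for \<open>y\<close> can be moved to
  \<open>(h f y + u) / L\<close> with \<open>u\<close> in a fixed finite range, and the same
  expression at \<open>y'\<close> is a witness there.\<close>

lemma cellular_ex:
  fixes P :: "('i \<Rightarrow> int) \<Rightarrow> bool"
  assumes "cellular P"
  shows "cellular (\<lambda>y. \<exists>z. P (y(i := z)))"
proof -
  have "finite {i}" by simp
  then obtain V T D where 1: "finite V" "{i} \<subseteq> V" "finite T" "D > 0" "\<forall>f\<in>T. affine_form V f"
    and P: "\<forall>y y'. (\<forall>f\<in>T. sgn (f y) = sgn (f y')) \<longrightarrow> (\<forall>i\<in>V. D dvd y i - y' i) \<longrightarrow> P y \<longrightarrow> P y'"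
    by (rule cellularE[OF assms])
  have upd: "(\<exists>k. \<forall>y z. f (y(i := z)) = k * z + f (y(i := 0))) \<and> affine_form V (\<lambda>y. f (y(i := 0)))"
    if "f \<in> T" for f
    by (rule affine_form_upd) (use that 1 in auto)
  then have "\<forall>f\<in>T. \<exists>k. \<forall>y z. f (y(i := z)) = k * z + f (y(i := 0))"
    by blast
  then obtain k where "\<forall>f\<in>T. \<forall>y z. f (y(i := z)) = k f * z + f (y(i := 0))"
    by (rule bchoice[THEN exE])
  then have k: "f (y(i := z)) = k f * z + f (y(i := 0))" if "f \<in> T" for f y z
    using that by blast
  have f0: "affine_form V (\<lambda>y. f (y(i := 0)))" if "f \<in> T" for f
    using upd[OF that] by blast
  define T1 where "T1 = {f\<in>T. k f \<noteq> 0}"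
  define L where "L = (\<Prod>f\<in>T1. \<bar>k f\<bar>)"
  have T1: "finite T1" "T1 \<subseteq> T"
    using 1(3) by (auto simp: T1_def)
  have L: "L > 0"
    unfolding L_def by (rule prod_pos) (auto simp: T1_def)
  have kL: "k f dvd L" if "f \<in> T1" for f
    unfolding L_def using T1(1) that dvd_prodI[of T1 f "\<lambda>f. \<bar>k f\<bar>"] by (simp add: o_def)
  \<comment> \<open>\<open>h f y\<close> is \<open>L\<close> times the rational zero of
    \<open>f\<close> as a function of \<open>z\<close>; it is an integer form because
    \<open>k f\<close> divides \<open>L\<close>.\<close>
  define h where "h f = (\<lambda>y. - (L div k f) * f (y(i := 0)))" for f :: "('i \<Rightarrow> int) \<Rightarrow> int"
  have h: "affine_form V (h f)" if "f \<in> T1" for f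
    unfolding h_def using that T1(2) by (intro affine_form_cmult f0) blast
  have sgn_h: "sgn (f (y(i := z))) = sgn (k f) * sgn (L * z - h f y)" if "f \<in> T1" for f y z
  proof -
    have kf: "k f \<noteq> 0" "f \<in> T"
      using that by (auto simp: T1_def)
    define r where "r = f (y(i := 0))"
    have "L * f (y(i := z)) = k f * (L * z) + L * r"
      unfolding k[OF kf(2), of y z] r_def by (simp add: algebra_simps)
    moreover have "L * r = k f * ((L div k f) * r)"
      using kL[OF that] by (simp flip: mult.assoc)
    moreover have "h f y = - ((L div k f) * r)"
      by (simp add: h_def r_def)
    ultimately have "L * f (y(i := z)) = k f * (L * z - h f y)"
      by (simp add: ring_distribs)
    then have "sgn (L * f (y(i := z))) = sgn (k f) * sgn (L * z - h f y)"
      by (simp add: sgn_mult)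
    then show ?thesis
      using L by (simp add: sgn_mult)
  qed
  \<comment> \<open>The first forms decide the sign of those \<open>f\<close> that do not involve
    \<open>z\<close>; the others compare a candidate \<open>h f y + s\<close> with each bound
    \<open>h g y\<close>.\<close>
  define T' where "T' = (\<lambda>f y. f (y(i := 0))) ` T
    \<union> (\<lambda>(f, g, s) y. h f y + s - h g y) ` (T1 \<times> T1 \<times> {- (L * D)..L * D})"
  have T'1: "sgn (f (y(i := 0))) = sgn (f (y'(i := 0)))"
    if "f \<in> T" "\<forall>f\<in>T'. sgn (f y) = sgn (f y')" for f y y'
    using bspec[OF that(2), of "\<lambda>y. f (y(i := 0))"] that(1) unfolding T'_def by blast
  have T'2: "sgn (h f y + s - h g y) = sgn (h f y' + s - h g y')"
    if "f \<in> T1" "g \<in> T1" "s \<in> {- (L * D)..L * D}" "\<forall>f\<in>T'. sgn (f y) = sgn (f y')" for f g s y y'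
  proof -
    have "(\<lambda>y. h f y + s - h g y) \<in> T'"
      unfolding T'_def using that(1-3) by (intro UnI2 image_eqI[of _ _ "(f, g, s)"]) auto
    from bspec[OF that(4) this] show ?thesis .
  qed
  show ?thesis
  proof (rule cellularI[of V T' "L * D"])
    show "finite V" "0 < L * D" "finite T'"
      using 1 L T1(1) by (auto simp: T'_def)
    show "affine_form V f" if "f \<in> T'" for f
      using that unfolding T'_def by (auto intro!: f0 h affine_form_diff affine_form_add affine_form_const)
    fix y y' assume "\<And>f. f \<in> T' \<Longrightarrow> sgn (f y) = sgn (f y')"
      and d: "\<And>j. j \<in> V \<Longrightarrow> L * D dvd y j - y' j" and "\<exists>z. P (y(i := z))"
    then obtain z where z: "P (y(i := z))" and s: "\<forall>f\<in>T'. sgn (f y) = sgn (f y')"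
      by blast
    have "\<exists>z'. D dvd z - z' \<and> (\<forall>f\<in>T1. sgn (L * z - h f y) = sgn (L * z' - h f y'))"
    proof (cases "T1 = {}")
      case True
      then show ?thesis
        by (intro exI[of _ z]) auto
    next
      case False
      obtain a u where au: "a \<in> (\<lambda>f. h f y) ` T1" "u \<in> {- (L * D)..L * D}" "L * D dvd a + u - L * z"
        "\<And>b. b \<in> (\<lambda>f. h f y) ` T1 \<Longrightarrow> sgn (L * z - b) = sgn (a + u - b)"
        using shift_near_finite_set[of "(\<lambda>f. h f y) ` T1" "L * D" "L * z"] T1(1) L 1(4) False
        by (metis finite_imageI image_is_empty mult_pos_pos)
      then obtain f where f: "f \<in> T1" "a = h f y"
        by blast
      \<comment> \<open>Why the modulus is \<open>L * D\<close>: the candidate at \<open>y'\<close>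
        becomes congruent to \<open>L * z\<close> modulo \<open>L * D\<close>, hence is
        \<open>L\<close> times an integer congruent to \<open>z\<close> modulo
        \<open>D\<close>.\<close>
      have "L * D dvd h f y - h f y'"
        by (rule affine_form_dvd_diff[OF h[OF f(1)]]) (rule d)
      with au(3) f(2) have "L * D dvd (h f y + u - L * z) - (h f y - h f y')"
        by (metis dvd_diff)
      then have "L * D dvd (h f y' + u) - L * z"
        by (simp add: algebra_simps)
      then obtain w where "h f y' + u - L * z = L * D * w"
        by (elim dvdE)
      then have w: "h f y' + u = L * (z + D * w)"
        by (simp add: algebra_simps)
      have "sgn (L * z - h g y) = sgn (L * (z + D * w) - h g y')" if "g \<in> T1" for g
        using au(4)[of "h g y"] T'2[OF f(1) that au(2) s] that by (simp add: f(2) flip: w)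
      then show ?thesis
        by (intro exI[of _ "z + D * w"]) auto
    qed
    then obtain z' where z': "D dvd z - z'" "\<And>f. f \<in> T1 \<Longrightarrow> sgn (L * z - h f y) = sgn (L * z' - h f y')"
      by blast
    have "P (y'(i := z'))"
    proof (rule P[rule_format, of "y(i := z)"])
      show "sgn (f (y(i := z))) = sgn (f (y'(i := z')))" if "f \<in> T" for f
      proof (cases "f \<in> T1")
        case True
        then show ?thesis by (simp add: sgn_h z'(2))
      next
        case False
        then have "k f = 0" using that by (simp add: T1_def)
        then show ?thesis using k[OF that, of y z] k[OF that, of y' z'] T'1[OF that s] by simp
      qed
      show "D dvd (y(i := z)) j - (y'(i := z')) j" if "j \<in> V" for j
        using d[OF that] z'(1) by (auto dest: dvd_mult_right)
    qed (rule z)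
    then show "\<exists>z. P (y'(i := z))" by blast
  qed
qed

section \<open>Dickson's lemma\<close>

text \<open>Finitely many measures on an arbitrary set replace coordinates, so that absolute values
  of forms can act as further coordinates. In the induction step \<open>F\<close> works for the old
  measures. Where \<psi> is at least its bound \<open>K\<close> on \<open>F\<close>, the same
  \<open>F\<close> still works; each of the finitely many levels of \<psi> below \<open>K\<close>
  gets its own finite set.\<close>

lemma dickson:
  fixes A :: "'a set" and \<Phi> :: "('a \<Rightarrow> nat) set"
  assumes "finite \<Phi>"
  shows "\<exists>F. finite F \<and> F \<subseteq> A \<and> (\<forall>x\<in>A. \<exists>m\<in>F. \<forall>\<phi>\<in>\<Phi>. \<phi> m \<le> \<phi> x)"
  using assms
proof (induction \<Phi> arbitrary: A)
  case empty
  show ?case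
  proof (cases "A = {}")
    case False
    then obtain x where "x \<in> A" by blast
    then show ?thesis by (intro exI[of _ "{x}"]) auto
  qed auto
next
  case (insert \<psi> \<Phi>)
  obtain F where F: "finite F" "F \<subseteq> A" "\<And>x. x \<in> A \<Longrightarrow> \<exists>m\<in>F. \<forall>\<phi>\<in>\<Phi>. \<phi> m \<le> \<phi> x"
    using insert.IH[of A] by auto
  \<comment> \<open>The inserted 0 keeps \<open>Max\<close> meaningful when \<open>F\<close> is
    empty.\<close>
  define K where "K = Max (insert 0 (\<psi> ` F))"
  have K: "\<psi> m \<le> K" if "m \<in> F" for m
    unfolding K_def using F(1) that by simp
  have "\<forall>c. \<exists>H. finite H \<and> H \<subseteq> {x\<in>A. \<psi> x = c} \<and> (\<forall>x\<in>{x\<in>A. \<psi> x = c}. \<exists>m\<in>H. \<forall>\<phi>\<in>\<Phi>. \<phi> m \<le> \<phi> x)"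
    using insert.IH by blast
  then obtain H where "\<forall>c. finite (H c) \<and> H c \<subseteq> {x\<in>A. \<psi> x = c} \<and>
      (\<forall>x\<in>{x\<in>A. \<psi> x = c}. \<exists>m\<in>H c. \<forall>\<phi>\<in>\<Phi>. \<phi> m \<le> \<phi> x)"
    by (rule choice[THEN exE])
  then have H: "\<And>c. finite (H c)" "\<And>c. H c \<subseteq> {x\<in>A. \<psi> x = c}"
    "\<And>c x. x \<in> A \<Longrightarrow> \<psi> x = c \<Longrightarrow> \<exists>m\<in>H c. \<forall>\<phi>\<in>\<Phi>. \<phi> m \<le> \<phi> x"
    by auto
  have "\<exists>m\<in>F \<union> (\<Union>c<K. H c). \<forall>\<phi>\<in>insert \<psi> \<Phi>. \<phi> m \<le> \<phi> x" if x: "x \<in> A" for x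
  proof (cases "\<psi> x < K")
    case True
    obtain m where "m \<in> H (\<psi> x)" "\<forall>\<phi>\<in>\<Phi>. \<phi> m \<le> \<phi> x"
      using H(3)[OF x refl] by blast
    moreover from this(1) have "\<psi> m = \<psi> x"
      using H(2) by blast
    ultimately show ?thesis
      using True by (intro bexI[of _ m]) auto
  next
    case False
    obtain m where "m \<in> F" "\<forall>\<phi>\<in>\<Phi>. \<phi> m \<le> \<phi> x"
      using F(3)[OF x] by blast
    then show ?thesis
      using K[of m] False by (intro bexI[of _ m]) auto
  qed
  moreover have "finite (F \<union> (\<Union>c<K. H c))" "F \<union> (\<Union>c<K. H c) \<subseteq> A"
    using F H(1) by simp (use F(2) H(2) in blast)
  ultimately show ?case by blast
qed

section \<open>Rational subsets of commutative monoids\<close>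

lemma one_in_set_star: "\<one>\<^bsub>G\<^esub> \<in> set_star G U"
  unfolding set_star_def by (rule UN_I[of 0]) simp_all

lemma set_star_mult:
  assumes "x \<in> set_star G U" "u \<in> U"
  shows "x \<otimes>\<^bsub>G\<^esub> u \<in> set_star G U"
proof -
  obtain k where "x \<in> set_power G U k"
    using assms(1) unfolding set_star_def by blast
  then have "x \<otimes>\<^bsub>G\<^esub> u \<in> set_power G U (Suc k)"
    using assms(2) by (auto simp: set_mult_def)
  then show ?thesis
    unfolding set_star_def by blast
qed

lemma set_star_induct [consumes 1, case_names one mult]:
  assumes "x \<in> set_star G U" "P \<one>\<^bsub>G\<^esub>"
    and "\<And>x u. x \<in> set_star G U \<Longrightarrow> P x \<Longrightarrow> u \<in> U \<Longrightarrow> P (x \<otimes>\<^bsub>G\<^esub> u)"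
  shows "P x"
proof -
  have "P x" if "x \<in> set_power G U k" for k x
    using that
  proof (induction k arbitrary: x)
    case (Suc k)
    then obtain y u where "y \<in> set_power G U k" "u \<in> U" "x = y \<otimes>\<^bsub>G\<^esub> u"
      by (auto simp: set_mult_def)
    moreover have "y \<in> set_star G U"
      using calculation(1) unfolding set_star_def by blast
    ultimately show ?case
      using Suc.IH assms(3) by blast
  qed (simp add: assms(2))
  then show ?thesis
    using assms(1) unfolding set_star_def by blast
qed

lemma set_star_mono:
  assumes "U \<subseteq> V"
  shows "set_star G U \<subseteq> set_star G V"
proof
  show "x \<in> set_star G V" if "x \<in> set_star G U" for x
    using that
    by (induction rule: set_star_induct) (use assms in \<open>auto intro: one_in_set_star set_star_mult\<close>)
qed

lemma rational_UN:
  assumes "finite I" "\<And>i. i \<in> I \<Longrightarrow> rational G (U i)"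
  shows "rational G (\<Union>i\<in>I. U i)"
  using assms by (induction I) (auto intro: rational.intros)

section \<open>Rational images of cells\<close>

context monoid
begin

lemma set_star_closed:
  assumes "U \<subseteq> carrier G"
  shows "set_star G U \<subseteq> carrier G"
proof
  show "x \<in> carrier G" if "x \<in> set_star G U" for x
    using that by (induction rule: set_star_induct) (use assms in auto)
qed

lemma rational_closed:
  assumes "rational G U"
  shows "U \<subseteq> carrier G"
  using assms
proof induction
  case (star U)
  show ?case by (rule set_star_closed[OF star.IH])
qed (auto simp: set_mult_def subset_iff)

lemma in_set_star:
  assumes "u \<in> U" "U \<subseteq> carrier G"
  shows "u \<in> set_star G U"
  using set_star_mult[OF one_in_set_star assms(1), of G] assms by (simp add: subset_iff)

lemma set_star_m_closed:
  assumes "x \<in> set_star G U" "y \<in> set_star G U" "U \<subseteq> carrier G"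
  shows "x \<otimes> y \<in> set_star G U"
  using assms(2)
proof (induction rule: set_star_induct)
  case one
  then show ?case
    using assms(1) set_star_closed[OF assms(3)] by auto
next
  case (mult y u)
  then have "x \<otimes> (y \<otimes> u) = (x \<otimes> y) \<otimes> u"
    using assms(1,3) set_star_closed[OF assms(3)] by (simp add: m_assoc subset_iff)
  then show ?case
    using mult set_star_mult by metis
qed

text \<open>\<open>B\<close> is generated from its minimal elements by \<open>M\<close>, and \<open>M\<close> from its minimal nonzero
  elements; both are finite in number by Dickson's lemma.\<close>

lemma rational_image_of_cone_module:
  fixes h :: "('i \<Rightarrow> nat) \<Rightarrow> 'a" and \<Phi> \<Psi> :: "(('i \<Rightarrow> nat) \<Rightarrow> nat) set"
  assumes h: "\<And>y. h y \<in> carrier G" "h (\<lambda>_. 0) = \<one>" "\<And>x y. h (\<lambda>i. x i + y i) = h x \<otimes> h y"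
    and V: "finite V" "\<And>m i. m \<in> M \<Longrightarrow> i \<notin> V \<Longrightarrow> m i = 0"
    and fin: "finite \<Phi>" "finite \<Psi>"
    and M: "(\<lambda>_. 0) \<in> M" "\<And>x y. x \<in> M \<Longrightarrow> y \<in> M \<Longrightarrow> (\<lambda>i. x i + y i) \<in> M"
      "\<And>x y. x \<in> M \<Longrightarrow> y \<in> M \<Longrightarrow> \<forall>\<psi>\<in>\<Psi>. \<psi> x \<le> \<psi> y \<Longrightarrow> \<exists>m\<in>M. y = (\<lambda>i. x i + m i)"
    and B: "\<And>x y. x \<in> B \<Longrightarrow> y \<in> M \<Longrightarrow> (\<lambda>i. x i + y i) \<in> B"
      "\<And>x y. x \<in> B \<Longrightarrow> y \<in> B \<Longrightarrow> \<forall>\<phi>\<in>\<Phi>. \<phi> x \<le> \<phi> y \<Longrightarrow> \<exists>m\<in>M. y = (\<lambda>i. x i + m i)"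
  shows "rational G (h ` B)"
proof -
  \<comment> \<open>The zero vector is excluded because subtracting it would not make the sum over
    \<open>V\<close> smaller.\<close>
  obtain F where F: "finite F" "F \<subseteq> M - {\<lambda>_. 0}" "\<forall>y\<in>M - {\<lambda>_. 0}. \<exists>x\<in>F. \<forall>\<psi>\<in>\<Psi>. \<psi> x \<le> \<psi> y"
    using dickson[OF fin(2)] by metis
  have "h m \<in> set_star G (h ` F)" if "m \<in> M" for m
    using that
  proof (induction "\<Sum>i\<in>V. m i" arbitrary: m rule: less_induct)
    case less
    show ?case
    proof (cases "m = (\<lambda>_. 0)")
      case True
      then show ?thesis by (simp add: h one_in_set_star)
    next
      case False
      then obtain x where x: "x \<in> F" "\<forall>\<psi>\<in>\<Psi>. \<psi> x \<le> \<psi> m"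
        using F(3) less.prems by blast
      then obtain y where y: "y \<in> M" "m = (\<lambda>i. x i + y i)"
        using M(3)[of x m] F(2) less.prems by blast
      have "x \<in> M" "x \<noteq> (\<lambda>_. 0)"
        using x(1) F(2) by auto
      then have "(\<Sum>i\<in>V. x i) \<noteq> 0"
        using V by (fastforce simp: fun_eq_iff)
      then have "h y \<in> set_star G (h ` F)"
        by (intro less.hyps y(1)) (simp add: y(2) sum.distrib)
      moreover have "h m = h y \<otimes> h x"
        unfolding y(2) h(3)[symmetric] by (simp add: add.commute)
      ultimately show ?thesis
        using set_star_mult[of "h y" G "h ` F" "h x"] x(1) by simp
    qed
  qed
  moreover have "v \<in> h ` M" if "v \<in> set_star G (h ` F)" for v
    using that
  proof (induction rule: set_star_induct)
    case one
    then show ?case using M(1) h(2) by (metis imageI)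
  next
    case (mult v u)
    then obtain x y where "x \<in> M" "v = h x" "y \<in> M" "u = h y"
      using F(2) by blast
    then show ?case
      using M(2)[of x y] h(3)[of x y] by (metis imageI)
  qed
  ultimately have hM: "h ` M = set_star G (h ` F)" by blast
  obtain H where H: "finite H" "H \<subseteq> B" "\<forall>y\<in>B. \<exists>x\<in>H. \<forall>\<phi>\<in>\<Phi>. \<phi> x \<le> \<phi> y"
    using dickson[OF fin(1)] by metis
  have "h ` B = h ` H <#> h ` M"
  proof (intro equalityI subsetI)
    fix v assume "v \<in> h ` B"
    then obtain y where y: "y \<in> B" "v = h y" by blast
    then obtain x where x: "x \<in> H" "\<forall>\<phi>\<in>\<Phi>. \<phi> x \<le> \<phi> y"
      using H(3) by blast
    then obtain m where "m \<in> M" "y = (\<lambda>i. x i + m i)"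
      using B(2)[of x y] H(2) y(1) by blast
    then show "v \<in> h ` H <#> h ` M"
      using x(1) unfolding set_mult_def y(2) by (auto simp: h(3))
  next
    fix v assume "v \<in> h ` H <#> h ` M"
    then obtain x m where "x \<in> H" "m \<in> M" "v = h x \<otimes> h m"
      unfolding set_mult_def by blast
    then show "v \<in> h ` B"
      using B(1)[of x m] H(2) h(3)[of x m] by (metis imageI subsetD)
  qed
  then show ?thesis
    unfolding hM using F(1) H(1) h(1) by (auto intro!: rational.intros)
qed

text \<open>Signs and residues cut the vectors supported in \<open>W\<close> into finitely many
  cells. The increments divisible by \<open>D\<close> whose linear part under each form respects the
  sign of that form on the cell make up a monoid acting on the cell. Conversely, if the coordinates
  and all |f| grow weakly from \<open>x\<close> to \<open>y\<close> within a cell, then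
  \<open>y - x\<close> is such an increment; hence absolute values serve as measures.\<close>

lemma rational_image_cellular:
  fixes h :: "('i \<Rightarrow> nat) \<Rightarrow> 'a"
  assumes h: "\<And>y. h y \<in> carrier G" "h (\<lambda>_. 0) = \<one>" "\<And>x y. h (\<lambda>i. x i + y i) = h x \<otimes> h y"
    and W: "finite W" and P: "cellular P"
  shows "rational G (h ` {y. (\<forall>i. i \<notin> W \<longrightarrow> y i = 0) \<and> P (int \<circ> y)})"
proof -
  obtain V T D where 1: "finite V" "W \<subseteq> V" "finite T" "D > 0" "\<forall>f\<in>T. affine_form V f"
    and det: "\<forall>y y'. (\<forall>f\<in>T. sgn (f y) = sgn (f y')) \<longrightarrow> (\<forall>i\<in>V. D dvd y i - y' i) \<longrightarrow> P y \<longrightarrow> P y'"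
    by (rule cellularE[OF P W])
  define L where "L f m = f (int \<circ> m) - f (\<lambda>_. 0)" for f :: "('i \<Rightarrow> int) \<Rightarrow> int" and m :: "'i \<Rightarrow> nat"
  have add: "f (int \<circ> (\<lambda>i. x i + m i)) = f (int \<circ> x) + L f m" if "f \<in> T" for f and x m :: "'i \<Rightarrow> nat"
    using affine_form_plus_arg[OF bspec[OF 1(5) that], of "int \<circ> x" "int \<circ> m"]
    by (simp add: L_def o_def)
  have L_add: "L f (\<lambda>i. x i + m i) = L f x + L f m" if "f \<in> T" for f and x m :: "'i \<Rightarrow> nat"
    using add[OF that, of x m] by (simp add: L_def)
  have L_0: "L f (\<lambda>_. 0) = 0" for f
    by (simp add: L_def o_def)
  have cell: "rational G (h ` {y. (\<forall>i. i \<notin> W \<longrightarrow> y i = 0) \<and>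
      (\<forall>f\<in>T. sgn (f (int \<circ> y)) = \<sigma> f) \<and> (\<forall>i\<in>V. int (y i) mod D = \<rho> i)})" for \<sigma> \<rho>
  proof -
    let ?B = "{y. (\<forall>i. i \<notin> W \<longrightarrow> y i = 0) \<and>
      (\<forall>f\<in>T. sgn (f (int \<circ> y)) = \<sigma> f) \<and> (\<forall>i\<in>V. int (y i) mod D = \<rho> i)}"
    \<comment> \<open>The weak form of the sign condition: the monoid must contain 0, and adding a
      quantity of this kind leaves the strict sign on the cell unchanged.\<close>
    let ?pos = "\<lambda>f x. (\<sigma> f = 1 \<longrightarrow> 0 \<le> x) \<and> (\<sigma> f = -1 \<longrightarrow> x \<le> 0) \<and> (\<sigma> f = 0 \<longrightarrow> x = 0)"
    let ?M = "{m. (\<forall>i. i \<notin> W \<longrightarrow> m i = 0) \<and> (\<forall>f\<in>T. ?pos f (L f m)) \<and> (\<forall>i\<in>V. D dvd int (m i))}"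
    let ?\<Phi> = "(\<lambda>i y. y i) ` W \<union> (\<lambda>f y. nat \<bar>f (int \<circ> y)\<bar>) ` T"
    let ?\<Psi> = "(\<lambda>i y. y i) ` W \<union> (\<lambda>f y. nat \<bar>L f y\<bar>) ` {f\<in>T. \<sigma> f \<in> {-1,0,1}}"
    have le: "\<forall>i. x i \<le> y i" if "\<forall>i. i \<notin> W \<longrightarrow> x i = 0" "\<forall>i\<in>W. x i \<le> y i" for x y :: "'i \<Rightarrow> nat"
      using that by (metis le0)
    show ?thesis
    proof (rule rational_image_of_cone_module[OF h W, where M = ?M and \<Phi> = ?\<Phi> and \<Psi> = ?\<Psi>])
      show "finite ?\<Phi>" "finite ?\<Psi>"
        using W 1(3) by auto
      show "(\<lambda>_. 0) \<in> ?M"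
        by (simp add: L_0)
      show "m i = 0" if "m \<in> ?M" "i \<notin> W" for m i
        using that by simp
      show "(\<lambda>i. x i + y i) \<in> ?M" if x: "x \<in> ?M" and y: "y \<in> ?M" for x y
      proof -
        have "?pos f (L f x + L f y)" if "f \<in> T" for f
        proof -
          have "?pos f (L f x)" "?pos f (L f y)"
            using x y that by auto
          then show ?thesis by auto
        qed
        then show ?thesis
          using x y by (simp add: L_add)
      qed
      show "(\<lambda>i. x i + y i) \<in> ?B" if x: "x \<in> ?B" and y: "y \<in> ?M" for x y
      proof -
        have "sgn (f (int \<circ> x) + L f y) = \<sigma> f" if "f \<in> T" for f
        proof -
          have "sgn (f (int \<circ> x)) = \<sigma> f" "?pos f (L f y)"
            using x y that by auto
          then show ?thesis
            by (auto simp: sgn_if split: if_splits)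
        qed
        moreover have "(int (x i) + int (y i)) mod D = \<rho> i" if "i \<in> V" for i
          using x y that by (metis (mono_tags, lifting) add.right_neutral dvd_imp_mod_0 mem_Collect_eq mod_add_right_eq)
        ultimately show ?thesis
          using x y by (auto simp: add)
      qed
      show "\<exists>m\<in>?M. y = (\<lambda>i. x i + m i)" if x: "x \<in> ?M" and y: "y \<in> ?M" and xy: "\<forall>\<psi>\<in>?\<Psi>. \<psi> x \<le> \<psi> y" for x y
      proof
        have "\<forall>i\<in>W. x i \<le> y i" "\<forall>f\<in>T. \<sigma> f \<in> {-1,0,1} \<longrightarrow> \<bar>L f x\<bar> \<le> \<bar>L f y\<bar>"
          using xy by (auto simp: ball_Un nat_le_eq_zle)
        then have i: "\<forall>i. x i \<le> y i" and f: "\<forall>f\<in>T. \<sigma> f \<in> {-1,0,1} \<longrightarrow> \<bar>L f x\<bar> \<le> \<bar>L f y\<bar>"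
          using le[of x y] x by auto
        show eq: "y = (\<lambda>i. x i + (y i - x i))"
          using i by auto
        have "L f (\<lambda>i. y i - x i) = L f y - L f x" if "f \<in> T" for f
          using L_add[OF that, of x "\<lambda>i. y i - x i"] unfolding eq[symmetric] by simp
        moreover have "?pos f (L f y - L f x)" if "f \<in> T" for f
        proof -
          have "?pos f (L f x)" "?pos f (L f y)" "\<sigma> f \<in> {-1,0,1} \<longrightarrow> \<bar>L f x\<bar> \<le> \<bar>L f y\<bar>"
            using x y f that by auto
          then show ?thesis by auto
        qed
        ultimately show "(\<lambda>i. y i - x i) \<in> ?M"
          using x y i by (auto simp: of_nat_diff)
      qed
      show "\<exists>m\<in>?M. y = (\<lambda>i. x i + m i)" if x: "x \<in> ?B" and y: "y \<in> ?B" and xy: "\<forall>\<psi>\<in>?\<Phi>. \<psi> x \<le> \<psi> y" for x y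
      proof
        have "\<forall>i\<in>W. x i \<le> y i" "\<forall>f\<in>T. \<bar>f (int \<circ> x)\<bar> \<le> \<bar>f (int \<circ> y)\<bar>"
          using xy by (auto simp: ball_Un nat_le_eq_zle)
        then have i: "\<forall>i. x i \<le> y i" and f: "\<forall>f\<in>T. \<bar>f (int \<circ> x)\<bar> \<le> \<bar>f (int \<circ> y)\<bar>"
          using le[of x y] x by auto
        show eq: "y = (\<lambda>i. x i + (y i - x i))"
          using i by auto
        have "L f (\<lambda>i. y i - x i) = f (int \<circ> y) - f (int \<circ> x)" if "f \<in> T" for f
          using add[OF that, of x "\<lambda>i. y i - x i"] unfolding eq[symmetric] by simp
        moreover have "?pos f (f (int \<circ> y) - f (int \<circ> x))" if "f \<in> T" for f
        proof -
          have "sgn (f (int \<circ> x)) = \<sigma> f" "sgn (f (int \<circ> y)) = \<sigma> f" "\<bar>f (int \<circ> x)\<bar> \<le> \<bar>f (int \<circ> y)\<bar>"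
            using x y f that by auto
          then show ?thesis by (auto simp: sgn_if split: if_splits)
        qed
        moreover have "D dvd int (y i) - int (x i)" if "i \<in> V" for i
        proof -
          have "int (y i) mod D = int (x i) mod D"
            using x y that by simp
          then show ?thesis
            by (simp only: mod_eq_dvd_iff)
        qed
        ultimately show "(\<lambda>i. y i - x i) \<in> ?M"
          using x y i by (auto simp: of_nat_diff)
      qed
    qed
  qed
  let ?Y = "{y. (\<forall>i. i \<notin> W \<longrightarrow> y i = 0) \<and> P (int \<circ> y)}"
  \<comment> \<open>\<open>restrict\<close> leaves only the values on \<open>T\<close> and
    \<open>V\<close>, so that there are finitely many signatures.\<close>
  define sig where "sig y = (restrict (\<lambda>f. sgn (f (int \<circ> y))) T, restrict (\<lambda>i. int (y i) mod D) V)"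
    for y :: "'i \<Rightarrow> nat"
  let ?C = "\<lambda>\<kappa>. {y. (\<forall>i. i \<notin> W \<longrightarrow> y i = 0) \<and>
      (\<forall>f\<in>T. sgn (f (int \<circ> y)) = fst \<kappa> f) \<and> (\<forall>i\<in>V. int (y i) mod D = snd \<kappa> i)}"
  have s: "sgn x \<in> {-1, 0, 1}" for x :: int
    by (simp add: sgn_if)
  have "sig ` ?Y \<subseteq> (T \<rightarrow>\<^sub>E {-1, 0, 1}) \<times> (V \<rightarrow>\<^sub>E {0..<D})"
    using 1(4) by (intro image_subsetI) (simp add: sig_def restrict_PiE_iff s del: insert_iff)
  then have "finite (sig ` ?Y)"
    by (rule finite_subset) (use 1(1,3) in \<open>auto intro!: finite_PiE\<close>)
  then have "rational G (\<Union>\<kappa>\<in>sig ` ?Y. h ` ?C \<kappa>)"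
    by (intro rational_UN cell)
  also have "(\<Union>\<kappa>\<in>sig ` ?Y. h ` ?C \<kappa>) = h ` (\<Union>\<kappa>\<in>sig ` ?Y. ?C \<kappa>)"
    by blast
  also have "(\<Union>\<kappa>\<in>sig ` ?Y. ?C \<kappa>) = ?Y"
  proof (intro equalityI subsetI)
    fix y assume "y \<in> ?Y"
    then show "y \<in> (\<Union>\<kappa>\<in>sig ` ?Y. ?C \<kappa>)"
      by (intro UN_I[of "sig y"]) (auto simp: sig_def)
  next
    fix y assume "y \<in> (\<Union>\<kappa>\<in>sig ` ?Y. ?C \<kappa>)"
    then obtain x where x: "x \<in> ?Y" "y \<in> ?C (sig x)" by blast
    have "P (int \<circ> y)"
    proof (rule det[rule_format])
      show "P (int \<circ> x)" using x(1) by simp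
      show "sgn (f (int \<circ> x)) = sgn (f (int \<circ> y))" if "f \<in> T" for f
        using x(2) that by (simp add: sig_def)
      show "D dvd (int \<circ> x) i - (int \<circ> y) i" if "i \<in> V" for i
        using x(2) that by (simp add: sig_def mod_eq_dvd_iff[symmetric])
    qed
    then show "y \<in> ?Y" using x(2) by simp
  qed
  finally show ?thesis .
qed

end

section \<open>Semilinear sets\<close>

text \<open>Finite unions of linear sets \<open>b F\<^sup>*\<close>, collected one at a time so that
  closure properties follow by induction on the union.\<close>

inductive semilinear :: "('a, 'm) monoid_scheme \<Rightarrow> 'a set \<Rightarrow> bool" for G where
  empty: "semilinear G {}"
| linear: "b \<in> carrier G \<Longrightarrow> finite F \<Longrightarrow> F \<subseteq> carrier G \<Longrightarrow> semilinear G U \<Longrightarrow>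
    semilinear G (({b} <#>\<^bsub>G\<^esub> set_star G F) \<union> U)"

context comm_monoid
begin

lemma set_mult_Un_left: "(U \<union> V) <#> W = (U <#> W) \<union> (V <#> W)"
  and set_mult_Un_right: "U <#> (V \<union> W) = (U <#> V) \<union> (U <#> W)"
  by (auto simp: set_mult_def)

text \<open>In a commutative monoid the factors of a product can be sorted by origin.\<close>

lemma set_star_Un:
  assumes "U \<subseteq> carrier G" "V \<subseteq> carrier G"
  shows "set_star G (U \<union> V) = set_star G U <#> set_star G V"
proof (intro equalityI subsetI)
  note closed = set_star_closed[OF assms(1)] set_star_closed[OF assms(2)]
  fix x assume "x \<in> set_star G (U \<union> V)"
  then show "x \<in> set_star G U <#> set_star G V"
  proof (induction rule: set_star_induct)
    case one
    then show ?case
      unfolding set_mult_def by (auto intro!: bexI[of _ \<one>] one_in_set_star)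
  next
    case (mult x w)
    then obtain u v where uv: "u \<in> set_star G U" "v \<in> set_star G V" "x = u \<otimes> v"
      unfolding set_mult_def by blast
    have c: "u \<in> carrier G" "v \<in> carrier G" "w \<in> carrier G"
      using uv closed mult(2) assms by auto
    have "x \<otimes> w = (u \<otimes> w) \<otimes> v" "x \<otimes> w = u \<otimes> (v \<otimes> w)"
      using c uv(3) by (simp_all add: m_ac)
    moreover have "u \<otimes> w \<in> set_star G U \<or> v \<otimes> w \<in> set_star G V"
      using mult(2) set_star_mult[OF uv(1), of w] set_star_mult[OF uv(2), of w] by auto
    ultimately have "\<exists>u'\<in>set_star G U. \<exists>v'\<in>set_star G V. x \<otimes> w = u' \<otimes> v'"
      using uv(1,2) by metis
    then show ?case
      unfolding set_mult_def by auto
  qed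
next
  fix x assume "x \<in> set_star G U <#> set_star G V"
  then obtain u v where "u \<in> set_star G U" "v \<in> set_star G V" "x = u \<otimes> v"
    unfolding set_mult_def by blast
  moreover from this have "u \<in> set_star G (U \<union> V)" "v \<in> set_star G (U \<union> V)"
    using set_star_mono[of U "U \<union> V" G] set_star_mono[of V "U \<union> V" G] by auto
  ultimately show "x \<in> set_star G (U \<union> V)"
    using assms by (auto intro: set_star_m_closed)
qed

text \<open>A nonempty product of factors \<open>b \<otimes> w\<close> collects to one
  \<open>b\<close>, further copies of \<open>b\<close> and an element of \<open>F\<^sup>*\<close>;
  the unit stands apart as the empty product.\<close>

lemma set_star_linear:
  assumes "b \<in> carrier G" "F \<subseteq> carrier G"
  shows "set_star G ({b} <#> set_star G F) = {\<one>} \<union> ({b} <#> set_star G (insert b F))"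
proof (intro equalityI subsetI)
  have bF: "insert b F \<subseteq> carrier G"
    using assms by simp
  note closed = set_star_closed[OF bF]
  note mono = set_star_mono[of F "insert b F" G]
  fix x assume "x \<in> set_star G ({b} <#> set_star G F)"
  then show "x \<in> {\<one>} \<union> ({b} <#> set_star G (insert b F))"
  proof (induction rule: set_star_induct)
    case (mult x u)
    then obtain w where w: "w \<in> set_star G (insert b F)" "u = b \<otimes> w"
      using mono unfolding set_mult_def by auto
    have c: "w \<in> carrier G"
      using w closed by auto
    show ?case
    proof (cases "x = \<one>")
      case True
      then show ?thesis
        using w c assms unfolding set_mult_def by auto
    next
      case False
      then obtain v where v: "v \<in> set_star G (insert b F)" "x = b \<otimes> v"
        using mult(3) unfolding set_mult_def by auto
      have "v \<otimes> (b \<otimes> w) \<in> set_star G (insert b F)"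
        by (intro set_star_m_closed v w in_set_star bF) simp
      moreover have "x \<otimes> u = b \<otimes> (v \<otimes> (b \<otimes> w))"
        using v w c closed assms(1) by (auto simp: m_assoc subset_iff)
      ultimately show ?thesis
        unfolding set_mult_def by auto
    qed
  qed simp
next
  have lin: "{b} <#> set_star G F \<subseteq> carrier G"
    using assms set_star_closed[OF assms(2)] unfolding set_mult_def by auto
  fix x assume "x \<in> {\<one>} \<union> ({b} <#> set_star G (insert b F))"
  then consider "x = \<one>" | v where "v \<in> set_star G (insert b F)" "x = b \<otimes> v"
    unfolding set_mult_def by auto
  then show "x \<in> set_star G ({b} <#> set_star G F)"
  proof cases
    case 2
    then obtain p q where pq: "p \<in> set_star G {b}" "q \<in> set_star G F" "v = p \<otimes> q"
      using set_star_Un[of "{b}" F] assms unfolding set_mult_def by auto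
    have c: "p \<in> carrier G" "q \<in> carrier G"
      using pq set_star_closed[of "{b}"] set_star_closed[OF assms(2)] assms(1) by auto
    \<comment> \<open>Backwards, \<open>b\<close> itself is a factor with trivial part from
      \<open>F\<^sup>*\<close>: the surplus copies of \<open>b\<close> become such factors, and all
      of \<open>q\<close> goes into one last factor.\<close>
    have "b \<in> {b} <#> set_star G F"
      using assms(1) one_in_set_star[of G F] unfolding set_mult_def by force
    then have "p \<in> set_star G ({b} <#> set_star G F)"
      using pq(1) set_star_mono[of "{b}" "{b} <#> set_star G F" G] by auto
    moreover have "b \<otimes> q \<in> {b} <#> set_star G F"
      using pq(2) unfolding set_mult_def by auto
    ultimately have "p \<otimes> (b \<otimes> q) \<in> set_star G ({b} <#> set_star G F)"
      by (rule set_star_mult)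
    then show ?thesis
      using 2 pq(3) c assms(1) by (simp add: m_lcomm)
  qed (simp add: one_in_set_star)
qed

lemma set_mult_linear:
  assumes "b \<in> carrier G" "c \<in> carrier G" "F \<subseteq> carrier G" "H \<subseteq> carrier G"
  shows "({b} <#> set_star G F) <#> ({c} <#> set_star G H) = {b \<otimes> c} <#> set_star G (F \<union> H)"
proof -
  have "(b \<otimes> u) \<otimes> (c \<otimes> v) = (b \<otimes> c) \<otimes> (u \<otimes> v)" if "u \<in> set_star G F" "v \<in> set_star G H" for u v
    using that assms set_star_closed[of F] set_star_closed[of H] by (auto simp: m_ac subset_iff)
  then show ?thesis
    unfolding set_star_Un[OF assms(3,4)] by (auto simp: set_mult_def)
qed

lemma semilinear_Un:
  assumes "semilinear G U" "semilinear G V"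
  shows "semilinear G (U \<union> V)"
  using assms by (induction) (simp_all add: Un_assoc semilinear.linear)

lemma semilinear_linear:
  assumes "b \<in> carrier G" "finite F" "F \<subseteq> carrier G"
  shows "semilinear G ({b} <#> set_star G F)"
  using semilinear.linear[OF assms semilinear.empty] by simp

lemma semilinear_set_mult:
  assumes "semilinear G U" "semilinear G V"
  shows "semilinear G (U <#> V)"
  using assms
proof (induction)
  case empty
  then show ?case by (simp add: set_mult_def semilinear.empty)
next
  case (linear b F U)
  have "semilinear G (({b} <#> set_star G F) <#> V)"
    using \<open>semilinear G V\<close>
  proof (induction)
    case empty
    then show ?case by (simp add: set_mult_def semilinear.empty)
  next
    case (linear c H V)
    then show ?case
      using \<open>b \<in> carrier G\<close> \<open>finite F\<close> \<open>F \<subseteq> carrier G\<close>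
      by (simp add: set_mult_Un_right set_mult_linear semilinear_Un semilinear_linear)
  qed
  with linear show ?case
    by (simp add: set_mult_Un_left semilinear_Un)
qed

lemma semilinear_closed:
  assumes "semilinear G U"
  shows "U \<subseteq> carrier G"
  using assms
proof induction
  case (linear b F U)
  then show ?case
    using set_star_closed[of F] by (auto simp: set_mult_def)
qed simp

lemma set_star_empty: "set_star G {} = {\<one>}"
proof -
  have "x = \<one>" if "x \<in> set_star G {}" for x
    using that by (induction rule: set_star_induct) auto
  then show ?thesis
    using one_in_set_star by auto
qed

lemma semilinear_singleton:
  assumes "b \<in> carrier G"
  shows "semilinear G {b}"
  using semilinear_linear[OF assms, of "{}"] assms by (simp add: set_star_empty set_mult_def)

text \<open>The star of a union is a product of stars, so linear sets can be treated one by
  one.\<close>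

lemma semilinear_set_star:
  assumes "semilinear G U"
  shows "semilinear G (set_star G U)"
  using assms
proof (induction)
  case empty
  then show ?case by (simp add: set_star_empty semilinear_singleton)
next
  case (linear b F U)
  have "semilinear G (set_star G ({b} <#> set_star G F))"
    unfolding set_star_linear[OF linear.hyps(1,3)]
    by (rule semilinear_Un[OF semilinear_singleton semilinear_linear]) (use linear.hyps in auto)
  moreover have "{b} <#> set_star G F \<subseteq> carrier G"
    by (rule semilinear_closed[OF semilinear_linear]) (use linear.hyps in auto)
  ultimately show ?case
    using set_star_Un[OF _ semilinear_closed[OF linear.hyps(4)]] linear.IH
    by (simp add: semilinear_set_mult)
qed

lemma semilinear_if_rational:
  assumes "rational G U"
  shows "semilinear G U"
  using assms
proof (induction)
  case (finite U)
  then show ?case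
    by (induction U) (use semilinear_Un[OF semilinear_singleton] in \<open>auto intro: semilinear.empty\<close>)
qed (auto intro: semilinear_Un semilinear_set_mult semilinear_set_star)

end

section \<open>Definable sets are rational\<close>

declare One_nat_def [simp del]

section \<open>Arithmetic with infinities\<close>

lemma ext_plus_simps [simp]:
  "ext_plus (Fin a) (Fin b) = Fin (a + b)"
  "ext_plus Minf x = Minf" "ext_plus x Minf = Minf"
  "ext_plus Pinf (Fin b) = Pinf" "ext_plus (Fin a) Pinf = Pinf" "ext_plus Pinf Pinf = Pinf"
  by (simp_all add: ext_plus_def)

lemma ext_plus_zero [simp]: "ext_plus (Fin 0) x = x" "ext_plus x (Fin 0) = x"
  by (cases x; simp)+

lemma ext_plus_assoc: "ext_plus (ext_plus x y) z = ext_plus x (ext_plus y z)"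
  by (cases x; cases y; cases z) simp_all

lemma ext_plus_commute: "ext_plus x y = ext_plus y x"
  by (cases x; cases y) simp_all

text \<open>The default 0 lets infinite summands drop out of integer sums; \<open>ext_value\<close>
  records them separately.\<close>

primrec fin_part :: "int extended \<Rightarrow> int" where
  "fin_part (Fin a) = a"
| "fin_part Pinf = 0"
| "fin_part Minf = 0"

text \<open>The value of a sum of extended integers, where \<open>m\<close> and \<open>p\<close> tell whether \<open>-\<infinity>\<close> and \<open>\<infinity>\<close>
  occur among the summands.\<close>

definition ext_value :: "bool \<Rightarrow> bool \<Rightarrow> int \<Rightarrow> int extended" where
  "ext_value m p a = (if m then Minf else if p then Pinf else Fin a)"

text \<open>-\<infinity> absorbs \<infinity>, and both absorb finite elements, so only the
  occurrence of each infinity counts and the flags combine by disjunction.\<close>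

lemma ext_value_plus:
  "ext_plus (ext_value m p a) (ext_value m' p' a') = ext_value (m \<or> m') (p \<or> p') (a + a')"
  by (simp add: ext_value_def)

text \<open>With the flags fixed, the comparison is constant unless both sides are finite.\<close>

lemma cellular_ext_value_le:
  assumes "affine_form V f" "affine_form V g" "finite V"
  shows "cellular (\<lambda>y. ext_value m p (f y) \<le> ext_value m' p' (g y))"
proof -
  have "cellular (\<lambda>y. f y \<le> g y)"
    using cellular_le_zero[OF affine_form_diff[OF assms(1,2)] assms(3)] by simp
  then show ?thesis
    by (cases m; cases p; cases m'; cases p') (simp_all add: ext_value_def cellular_const)
qed

lemma finite_free_vars: "finite (free_vars P)"
  by (induction P) auto

lemma cellular_nonneg:
  assumes "finite V"
  shows "cellular (\<lambda>y. \<forall>i\<in>V. 0 \<le> y i)"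
proof (rule cellular_ball[OF assms])
  show "cellular (\<lambda>y. 0 \<le> y i)" for i :: 'a
    using cellular_le_zero[OF affine_form_cmult[OF affine_form_proj, of "{i}" i "-1"]] by simp
qed

lemma comm_monoid_power_monoid:
  assumes "comm_monoid S"
  shows "comm_monoid (power_monoid S n)"
proof -
  interpret comm_monoid S by fact
  show ?thesis
    unfolding power_monoid_def
    by (rule comm_monoidI) (auto simp: PiE_iff extensional_def fun_eq_iff m_ac)
qed

text \<open>Commutativity reduces an element of the star to one exponent per generator, the
  quantities over which formulas will quantify.\<close>

lemma (in comm_monoid) set_star_eq_finprod:
  assumes "finite F" "F \<subseteq> carrier G"
  shows "set_star G F = range (\<lambda>k. \<Otimes>f\<in>F. f [^] (k f :: nat))"
proof (intro equalityI subsetI)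
  fix x assume "x \<in> set_star G F"
  then show "x \<in> range (\<lambda>k. \<Otimes>f\<in>F. f [^] (k f :: nat))"
  proof (induction rule: set_star_induct)
    case one
    then show ?case
      by (intro range_eqI[of _ _ "\<lambda>_. 0"]) simp
  next
    case (mult x u)
    then obtain k :: "'a \<Rightarrow> nat" where k: "x = (\<Otimes>f\<in>F. f [^] k f)" by blast
    have "u = (\<Otimes>f\<in>F. if u = f then f else \<one>)"
      using assms mult(2) by (subst finprod_singleton) auto
    then have "x \<otimes> u = (\<Otimes>f\<in>F. f [^] k f \<otimes> (if u = f then f else \<one>))"
      unfolding k using assms(2) by (subst finprod_multf) auto
    also have "\<dots> = (\<Otimes>f\<in>F. f [^] ((k(u := Suc (k u))) f))"
      by (rule finprod_cong') (use assms(2) in auto)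
    finally show ?case
      by (rule range_eqI[where x = "k(u := Suc (k u))"])
  qed
next
  have pow: "f [^] (k :: nat) \<in> set_star G F" if "f \<in> F" for f k
    by (induction k) (auto intro: one_in_set_star set_star_mult that)
  fix x assume "x \<in> range (\<lambda>k. \<Otimes>f\<in>F. f [^] (k f :: nat))"
  then obtain k :: "'a \<Rightarrow> nat" where x: "x = (\<Otimes>f\<in>F. f [^] k f)" by blast
  have "H \<subseteq> F \<Longrightarrow> (\<Otimes>f\<in>H. f [^] k f) \<in> set_star G F" if "finite H" for H
    using that
  proof (induction H)
    case (insert f H)
    then have "(\<Otimes>f\<in>insert f H. f [^] k f) = f [^] k f \<otimes> (\<Otimes>f\<in>H. f [^] k f)"
      using assms(2) by (intro finprod_insert) auto
    then show ?case
      using insert pow by (simp add: set_star_m_closed[OF _ _ assms(2)])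
  qed (simp add: one_in_set_star)
  then show "x \<in> set_star G F"
    using assms(1) x by blast
qed

section \<open>Evaluating formulas over extended integers\<close>

text \<open>Covers all five semirings at once. Addition enters formulas only through the natural
  order, and reversing that order exchanges the two sides of an atom.\<close>

locale extended_int_monoid =
  fixes S :: "int extended ring" (structure) and A :: "int set" and I :: "int extended set"
  assumes carrier_eq: "carrier S = Fin ` A \<union> I"
    and A: "A = UNIV \<or> A = {0..}"
    and I: "I \<subseteq> {Minf, Pinf}"
    and mult_eq: "monoid.mult S = ext_plus"
    and one_eq: "\<one> = Fin 0"
    and natural_le_eq: "natural_le S = (\<le>) \<or> natural_le S = (\<ge>)"
begin

lemma Fin_in_carrier: "Fin a \<in> carrier S \<longleftrightarrow> a \<in> A"
  using I unfolding carrier_eq by auto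

sublocale comm_monoid S
proof (rule comm_monoidI)
  show "x \<otimes> y \<in> carrier S" if "x \<in> carrier S" "y \<in> carrier S" for x y
    using that A by (cases x; cases y) (auto simp: Fin_in_carrier mult_eq)
  show "\<one> \<in> carrier S"
    using A unfolding carrier_eq one_eq by auto
qed (auto simp: mult_eq one_eq ext_plus_assoc intro: ext_plus_commute)

text \<open>The tests \<open>k \<noteq> 0\<close> reflect that the zeroth power of an infinite
  element is the unit \<open>Fin 0\<close>.\<close>

lemma nat_pow_eq: "x [^] (k :: nat) = ext_value (k \<noteq> 0 \<and> x = Minf) (k \<noteq> 0 \<and> x = Pinf) (int k * fin_part x)"
proof (induction k)
  case (Suc k)
  then show ?case
    by (cases x) (auto simp: mult_eq ext_value_def algebra_simps)
qed (simp add: one_eq ext_value_def)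

lemma finprod_eq:
  assumes "finite J" "\<And>j. j \<in> J \<Longrightarrow> x j \<in> carrier S"
  shows "(\<Otimes>j\<in>J. x j [^] (k j :: nat)) =
    ext_value (\<exists>j\<in>J. k j \<noteq> 0 \<and> x j = Minf) (\<exists>j\<in>J. k j \<noteq> 0 \<and> x j = Pinf) (\<Sum>j\<in>J. int (k j) * fin_part (x j))"
  using assms
proof (induction J)
  case empty
  then show ?case by (simp add: one_eq ext_value_def)
next
  case (insert j J)
  then have "(\<Otimes>i\<in>insert j J. x i [^] k i) = x j [^] k j \<otimes> (\<Otimes>i\<in>J. x i [^] k i)"
    by (intro finprod_insert) auto
  then show ?case
    using insert by (simp add: mult_eq nat_pow_eq ext_value_plus)
qed

text \<open>The sign -1 is available only for \<open>A = UNIV\<close>.\<close>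

definition signs :: "int set" where
  "signs = {s \<in> {1, -1}. \<forall>z\<ge>0. s * z \<in> A}"

text \<open>Where \<open>b i\<close> is infinite, \<open>y i\<close> is absorbed; it remains as a
  dummy coordinate, so that all patterns share the same parameter space.\<close>

definition point :: "('i \<Rightarrow> int extended) \<Rightarrow> ('i \<Rightarrow> int) \<Rightarrow> ('i \<Rightarrow> int) \<Rightarrow> 'i \<Rightarrow> int extended" where
  "point b s y i = ext_plus (b i) (Fin (s i * y i))"

lemma point_closed:
  assumes "b i \<in> insert (Fin 0) I" "s i \<in> signs" "0 \<le> y i"
  shows "point b s y i \<in> carrier S"
  using assms I unfolding carrier_eq point_def signs_def by auto

lemma carrier_point:
  assumes "a \<in> carrier S"
  shows "\<exists>c\<in>insert (Fin 0) I. \<exists>t\<in>signs. \<exists>z\<ge>0. a = ext_plus c (Fin (t * z))"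
proof -
  have 1: "1 \<in> signs"
    using A by (auto simp: signs_def)
  consider a' where "a = Fin a'" "a' \<in> A" | "a \<in> I"
    using assms unfolding carrier_eq by blast
  then show ?thesis
  proof cases
    case 1
    have "(if a' \<ge> 0 then 1 else -1) \<in> signs"
      using A 1(2) by (auto simp: signs_def)
    moreover have "a = ext_plus (Fin 0) (Fin ((if a' \<ge> 0 then 1 else -1) * \<bar>a'\<bar>))"
      using 1 by simp
    ultimately show ?thesis
      using abs_ge_zero by blast
  next
    case 2
    then show ?thesis
      using 1 by (intro bexI[of _ a] bexI[of _ 1] exI[of _ 0]) auto
  qed
qed

text \<open>Nonnegativity belongs to the predicate because it ensures that \<open>point\<close>
  takes values in the carrier, where products can be evaluated. A quantifier over \<open>S\<close>
  splits into a finite choice of pattern and sign for its variable and an integer quantifier over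
  \<open>z \<ge> 0\<close>; hence \<open>b\<close> and \<open>s\<close> vary in the
  induction.\<close>

lemma cellular_holds:
  assumes "\<And>i. i \<in> free_vars P \<Longrightarrow> b i \<in> insert (Fin 0) I" "\<And>i. i \<in> free_vars P \<Longrightarrow> s i \<in> signs"
  shows "cellular (\<lambda>y. (\<forall>i\<in>free_vars P. 0 \<le> y i) \<and> holds S P (point b s y))"
  using assms
proof (induction P arbitrary: b s)
  case (Atom n k r)
  \<comment> \<open>One side of the atom as an expression in all integer \<open>y\<close>, agreeing
    with the product for nonnegative \<open>y\<close>; infinite variables get coefficient 0 and act
    through the flags only.\<close>
  define val where "val k y = ext_value (\<exists>i\<in>{1..n}. k i \<noteq> 0 \<and> b i = Minf) (\<exists>i\<in>{1..n}. k i \<noteq> 0 \<and> b i = Pinf)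
    (\<Sum>i\<in>{1..n}. (if b i = Fin 0 then int (k i) * s i else 0) * y i)" for k :: "nat \<Rightarrow> nat" and y
  have val: "(\<Otimes>i\<in>{1..n}. point b s y i [^] k i) = val k y" if "\<forall>i\<in>{1..n}. 0 \<le> y i" for k :: "nat \<Rightarrow> nat" and y
  proof -
    have b: "b i = Fin 0 \<or> b i = Minf \<or> b i = Pinf" if "i \<in> {1..n}" for i
      using Atom(1)[of i] I that by auto
    have p: "point b s y i = Minf \<longleftrightarrow> b i = Minf" "point b s y i = Pinf \<longleftrightarrow> b i = Pinf"
      "fin_part (point b s y i) = (if b i = Fin 0 then s i else 0) * y i" if "i \<in> {1..n}" for i
      using b[OF that] by (auto simp: point_def)
    have "(\<Otimes>i\<in>{1..n}. point b s y i [^] k i) = ext_value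
      (\<exists>i\<in>{1..n}. k i \<noteq> 0 \<and> point b s y i = Minf) (\<exists>i\<in>{1..n}. k i \<noteq> 0 \<and> point b s y i = Pinf)
      (\<Sum>i\<in>{1..n}. int (k i) * fin_part (point b s y i))"
      using that Atom by (intro finprod_eq point_closed) auto
    also have "\<dots> = val k y"
      unfolding val_def by (intro arg_cong3[of _ _ _ _ _ _ ext_value] bex_cong sum.cong) (auto simp: p)
    finally show ?thesis .
  qed
  have "cellular (\<lambda>y. natural_le S (val k y) (val r y))"
    using natural_le_eq
  proof
    assume "natural_le S = (\<le>)"
    then show ?thesis
      unfolding val_def by (simp add: cellular_ext_value_le[where V = "{1..n}"] affine_form_sum)
  next
    assume "natural_le S = (\<ge>)"
    then show ?thesis
      unfolding val_def by (simp add: cellular_ext_value_le[where V = "{1..n}"] affine_form_sum)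
  qed
  then have "cellular (\<lambda>y. (\<forall>i\<in>{1..n}. 0 \<le> y i) \<and> natural_le S (val k y) (val r y))"
    by (intro cellular_conj cellular_nonneg) auto
  also have "(\<lambda>y. (\<forall>i\<in>{1..n}. 0 \<le> y i) \<and> natural_le S (val k y) (val r y)) =
      (\<lambda>y. (\<forall>i\<in>free_vars (Atom n k r). 0 \<le> y i) \<and> holds S (Atom n k r) (point b s y))"
    by (rule ext) (simp only: val free_vars.simps holds.simps cong: conj_cong)
  finally show ?case .
next
  case (Conj P Q)
  have "cellular (\<lambda>y. ((\<forall>i\<in>free_vars P. 0 \<le> y i) \<and> holds S P (point b s y))
      \<and> ((\<forall>i\<in>free_vars Q. 0 \<le> y i) \<and> holds S Q (point b s y)))"
    by (intro cellular_conj Conj.IH) (use Conj.prems in auto)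
  then show ?case
    by (rule back_subst[of cellular]) auto
next
  case (Disj P Q)
  have "cellular (\<lambda>y. (\<forall>i\<in>free_vars P \<union> free_vars Q. 0 \<le> y i) \<and>
      (((\<forall>i\<in>free_vars P. 0 \<le> y i) \<and> holds S P (point b s y))
      \<or> ((\<forall>i\<in>free_vars Q. 0 \<le> y i) \<and> holds S Q (point b s y))))"
    by (intro cellular_conj cellular_disj Disj.IH cellular_nonneg) (use Disj.prems in \<open>auto simp: finite_free_vars\<close>)
  then show ?case
    by (rule back_subst[of cellular]) auto
next
  case (Neg P)
  \<comment> \<open>Nonnegativity is imposed again, since the negated predicate also admits negative
    arguments.\<close>
  have "cellular (\<lambda>y. (\<forall>i\<in>free_vars P. 0 \<le> y i) \<and>
      \<not> ((\<forall>i\<in>free_vars P. 0 \<le> y i) \<and> holds S P (point b s y)))"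
    by (intro cellular_conj cellular_not Neg.IH cellular_nonneg) (use Neg.prems in \<open>auto simp: finite_free_vars\<close>)
  then show ?case
    by (rule back_subst[of cellular]) auto
next
  case (Ex i P)
  \<comment> \<open>\<open>0 \<le> y i\<close> is stated separately, since \<open>i\<close> may fail
    to be free in \<open>P\<close>.\<close>
  let ?Q = "\<lambda>(c, t) y. 0 \<le> y i \<and> (\<forall>j\<in>free_vars P. 0 \<le> y j) \<and> holds S P (point (b(i := c)) (s(i := t)) y)"
  let ?K = "insert (Fin 0) I \<times> signs"
  have upd: "(point b s y)(i := ext_plus c (Fin (t * z))) = point (b(i := c)) (s(i := t)) (y(i := z))" for y c t z
    by (auto simp: point_def)
  have "cellular (\<lambda>y. \<exists>z. ?Q ct (y(i := z)))" if "ct \<in> ?K" for ct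
  proof (rule cellular_ex)
    show "cellular (?Q ct)"
      unfolding split_def
      using cellular_nonneg[of "{i}"] that Ex.prems
      by (intro cellular_conj[OF _ Ex.IH]) auto
  qed
  moreover have "finite ?K"
    using I finite_subset[of signs "{1, -1}"] finite_subset[OF I] by (auto simp: signs_def)
  ultimately have "cellular (\<lambda>y. (\<forall>j\<in>free_vars P - {i}. 0 \<le> y j) \<and> (\<exists>ct\<in>?K. \<exists>z. ?Q ct (y(i := z))))"
    by (intro cellular_conj cellular_bex cellular_nonneg) (auto simp: finite_free_vars)
  also have "(\<lambda>y. (\<forall>j\<in>free_vars P - {i}. 0 \<le> y j) \<and> (\<exists>ct\<in>?K. \<exists>z. ?Q ct (y(i := z)))) =
      (\<lambda>y. (\<forall>j\<in>free_vars (Ex i P). 0 \<le> y j) \<and> holds S (Ex i P) (point b s y))"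
  proof (intro ext iffI; elim conjE)
    fix y assume y: "\<forall>j\<in>free_vars P - {i}. 0 \<le> y j" and "\<exists>ct\<in>?K. \<exists>z. ?Q ct (y(i := z))"
    then obtain c t z where ctz: "c \<in> insert (Fin 0) I" "t \<in> signs" "0 \<le> z"
      "holds S P (point (b(i := c)) (s(i := t)) (y(i := z)))"
      by auto
    have "ext_plus c (Fin (t * z)) \<in> carrier S"
      using point_closed[of "\<lambda>_. c" i "\<lambda>_. t" "\<lambda>_. z"] ctz by (simp add: point_def)
    then show "(\<forall>j\<in>free_vars (Ex i P). 0 \<le> y j) \<and> holds S (Ex i P) (point b s y)"
      using y ctz(4) by (auto simp flip: upd)
  next
    fix y assume y: "\<forall>j\<in>free_vars (Ex i P). 0 \<le> y j" and "holds S (Ex i P) (point b s y)"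
    then obtain a where a: "a \<in> carrier S" "holds S P ((point b s y)(i := a))"
      by auto
    then obtain c t z where ctz: "c \<in> insert (Fin 0) I" "t \<in> signs" "0 \<le> z" "a = ext_plus c (Fin (t * z))"
      using carrier_point[OF a(1)] by blast
    then have "?Q (c, t) (y(i := z))"
      using y a(2) by (auto simp: upd)
    then show "(\<forall>j\<in>free_vars P - {i}. 0 \<le> y j) \<and> (\<exists>ct\<in>?K. \<exists>z. ?Q ct (y(i := z)))"
      using y ctz(1,2) by (intro conjI bexI[of _ "(c, t)"] exI[of _ z]) auto
  qed
  finally show ?case .
qed

text \<open>Passes between the total function \<open>point b s y\<close> and its restriction to
  \<open>{1..n}\<close>, an element of the power monoid.\<close>

lemma holds_cong:
  assumes "\<And>i. i \<in> free_vars P \<Longrightarrow> x i = y i" "\<And>i. i \<in> free_vars P \<Longrightarrow> y i \<in> carrier S"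
  shows "holds S P x \<longleftrightarrow> holds S P y"
  using assms
proof (induction P arbitrary: x y)
  case (Atom n k r)
  have xy: "x i = y i" "y i \<in> carrier S" if "i \<in> {1..n}" for i
    using Atom(1)[of i] Atom(2)[of i] that by simp_all
  have "(\<Otimes>i\<in>{1..n}. x i [^] k i) = (\<Otimes>i\<in>{1..n}. y i [^] k i)" for k :: "nat \<Rightarrow> nat"
    by (rule finprod_cong') (simp_all add: xy Pi_iff)
  from this[of k] this[of r] show ?case
    by (simp only: holds.simps)
next
  case (Conj P Q)
  have "holds S P x \<longleftrightarrow> holds S P y"
    by (rule Conj.IH(1)) (simp_all add: Conj.prems)
  moreover have "holds S Q x \<longleftrightarrow> holds S Q y"
    by (rule Conj.IH(2)) (simp_all add: Conj.prems)
  ultimately show ?case by simp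
next
  case (Disj P Q)
  have "holds S P x \<longleftrightarrow> holds S P y"
    by (rule Disj.IH(1)) (simp_all add: Disj.prems)
  moreover have "holds S Q x \<longleftrightarrow> holds S Q y"
    by (rule Disj.IH(2)) (simp_all add: Disj.prems)
  ultimately show ?case by simp
next
  case (Neg P)
  have "holds S P x \<longleftrightarrow> holds S P y"
    by (rule Neg.IH) (simp_all add: Neg.prems)
  then show ?case by simp
next
  case (Ex i P)
  have "holds S P (x(i := a)) \<longleftrightarrow> holds S P (y(i := a))" if "a \<in> carrier S" for a
    by (rule Ex.IH) (simp_all add: Ex.prems that)
  then show ?case by auto
qed

lemma carrier_power_monoid: "carrier (power_monoid S n) = {1..n} \<rightarrow>\<^sub>E carrier S"
  by (simp add: power_monoid_def)

lemma mult_power_monoid: "x \<otimes>\<^bsub>power_monoid S n\<^esub> y = (\<lambda>i\<in>{1..n}. ext_plus (x i) (y i))"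
  by (simp add: power_monoid_def mult_eq)

lemma one_power_monoid: "\<one>\<^bsub>power_monoid S n\<^esub> = (\<lambda>i\<in>{1..n}. Fin 0)"
  by (simp add: power_monoid_def one_eq)

text \<open>For fixed \<open>b\<close> and \<open>s\<close> the points are
  \<open>b \<otimes> h s y\<close> with \<open>h s\<close> a homomorphism on vectors of naturals, so
  \<open>D\<close> is a finite union of translates of homomorphic images of cellular sets. The
  pieces may overlap.\<close>

lemma rational_if_definable:
  assumes "definable S n D"
  shows "rational (power_monoid S n) D"
proof -
  interpret G: comm_monoid "power_monoid S n"
    by (rule comm_monoid_power_monoid) (rule comm_monoid_axioms)
  obtain P where P: "free_vars P = {1..n}" "D = {x \<in> {1..n} \<rightarrow>\<^sub>E carrier S. holds S P x}"
    using assms unfolding definable_def carrier_power_monoid by blast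
  define Q where "Q b s y \<longleftrightarrow> (\<forall>i\<in>{1..n}. 0 \<le> y i) \<and> holds S P (point b s y)" for b s y
  define h where "h s y = (\<lambda>i\<in>{1..n}. Fin (s i * int (y i)))" for s and y :: "nat \<Rightarrow> nat"
  define Y where "Y b s = {y. (\<forall>i. i \<notin> {1..n} \<longrightarrow> y i = 0) \<and> Q b s (int \<circ> y)}" for b s
  let ?B = "{1..n} \<rightarrow>\<^sub>E insert (Fin 0) I" and ?\<Sigma> = "{1..n} \<rightarrow>\<^sub>E signs"
  have piece: "restrict (point b s (int \<circ> y)) {1..n} = b \<otimes>\<^bsub>power_monoid S n\<^esub> h s y" for b s y
    by (auto simp: mult_power_monoid h_def point_def)
  have eq: "D = (\<Union>(b, s)\<in>?B \<times> ?\<Sigma>. {b} <#>\<^bsub>power_monoid S n\<^esub> h s ` Y b s)"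
  proof (intro equalityI subsetI)
    fix x assume "x \<in> D"
    then have x: "x \<in> {1..n} \<rightarrow>\<^sub>E carrier S" "holds S P x"
      using P(2) by auto
    have xc: "x i \<in> carrier S" if "i \<in> {1..n}" for i
      using x(1) that by (rule PiE_mem)
    have "\<exists>c t z. c \<in> insert (Fin 0) I \<and> t \<in> signs \<and> z \<ge> 0 \<and> x i = ext_plus c (Fin (t * z))" if "i \<in> {1..n}" for i
      using carrier_point[of "x i"] x(1) that by blast
    then obtain b s z where bsz: "\<And>i. i \<in> {1..n} \<Longrightarrow> b i \<in> insert (Fin 0) I" "\<And>i. i \<in> {1..n} \<Longrightarrow> s i \<in> signs"
      "\<And>i. i \<in> {1..n} \<Longrightarrow> z i \<ge> 0" "\<And>i. i \<in> {1..n} \<Longrightarrow> x i = ext_plus (b i) (Fin (s i * z i))"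
      by metis
    define b' where "b' = restrict b {1..n}"
    define s' where "s' = restrict s {1..n}"
    define y where "y i = (if i \<in> {1..n} then nat (z i) else 0)" for i
    have pt: "point b' s' (int \<circ> y) i = x i" if "i \<in> {1..n}" for i
      using bsz(3,4)[OF that] that by (auto simp: point_def b'_def s'_def y_def)
    have "holds S P (point b' s' (int \<circ> y)) \<longleftrightarrow> holds S P x"
      by (rule holds_cong) (simp_all only: P(1) pt xc)
    then have "holds S P (point b' s' (int \<circ> y))"
      using x(2) by blast
    then have "y \<in> Y b' s'"
      by (simp add: Y_def Q_def y_def)
    moreover have "x = b' \<otimes>\<^bsub>power_monoid S n\<^esub> h s' y"
      unfolding piece[symmetric] using x(1) pt by (auto simp: PiE_iff extensional_def)
    moreover have "b' \<in> ?B" "s' \<in> ?\<Sigma>"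
      using bsz(1,2) by (auto simp: b'_def s'_def)
    ultimately show "x \<in> (\<Union>(b, s)\<in>?B \<times> ?\<Sigma>. {b} <#>\<^bsub>power_monoid S n\<^esub> h s ` Y b s)"
      unfolding set_mult_def by blast
  next
    fix x assume "x \<in> (\<Union>(b, s)\<in>?B \<times> ?\<Sigma>. {b} <#>\<^bsub>power_monoid S n\<^esub> h s ` Y b s)"
    then obtain b s y where bsy: "b \<in> ?B" "s \<in> ?\<Sigma>" "y \<in> Y b s" "x = restrict (point b s (int \<circ> y)) {1..n}"
      unfolding set_mult_def piece by auto
    then have x: "x i = point b s (int \<circ> y) i" "x i \<in> carrier S" if "i \<in> {1..n}" for i
      using that point_closed[of b i s "int \<circ> y"] PiE_mem[OF bsy(1) that] PiE_mem[OF bsy(2) that]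
      by (simp_all add: bsy(4))
    have "holds S P (point b s (int \<circ> y)) \<longleftrightarrow> holds S P x"
      by (rule holds_cong) (simp_all only: P(1) x(1)[symmetric] x(2))
    then have "holds S P x"
      using bsy(3) by (simp add: Y_def Q_def)
    then show "x \<in> D"
      using P(2) x(2) bsy(4) by auto
  qed
  have "rational (power_monoid S n) ({b} <#>\<^bsub>power_monoid S n\<^esub> h s ` Y b s)" if "b \<in> ?B" "s \<in> ?\<Sigma>" for b s
  proof (rule rational.product[OF rational.finite])
    have "insert (Fin 0) I \<subseteq> carrier S"
      using one_closed unfolding one_eq by (simp add: carrier_eq)
    then have "?B \<subseteq> {1..n} \<rightarrow>\<^sub>E carrier S"
      by (intro PiE_mono)
    then show "{b} \<subseteq> carrier (power_monoid S n)"
      using that(1) unfolding carrier_power_monoid by blast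
    have "cellular (Q b s)"
      unfolding Q_def P(1)[symmetric]
      by (rule cellular_holds) (use PiE_mem[OF that(1)] PiE_mem[OF that(2)] in \<open>simp_all only: P(1)\<close>)
    moreover have "h s y \<in> carrier (power_monoid S n)" for y
    proof -
      have "Fin (s i * int (y i)) \<in> carrier S" if "i \<in> {1..n}" for i
        using point_closed[of "\<lambda>_. Fin 0" i s "int \<circ> y"] PiE_mem[OF \<open>s \<in> ?\<Sigma>\<close> that] by (simp add: point_def)
      then show ?thesis
        unfolding carrier_power_monoid h_def by auto
    qed
    moreover have "h s (\<lambda>_. 0) = \<one>\<^bsub>power_monoid S n\<^esub>"
      by (simp add: h_def one_power_monoid)
    moreover have "h s (\<lambda>i. x i + y i) = h s x \<otimes>\<^bsub>power_monoid S n\<^esub> h s y" for x y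
      by (auto simp: h_def mult_power_monoid distrib_left)
    ultimately show "rational (power_monoid S n) (h s ` Y b s)"
      unfolding Y_def by (intro G.rational_image_cellular) simp_all
  qed simp
  moreover have "finite ?B" "finite ?\<Sigma>"
    using finite_subset[OF I] finite_subset[of signs "{1, -1}"] by (auto intro!: finite_PiE simp: signs_def)
  ultimately show ?thesis
    unfolding eq by (intro rational_UN) auto
qed

section \<open>Rational sets are definable\<close>

text \<open>Arbitrary assignments replace elements of the power monoid, so that variables can be
  added and quantified away. \<open>free_vars P = V\<close> is exact, as \<open>definable\<close>
  demands; relations to be combined therefore share one \<open>V\<close>.\<close>

definition fo_definable :: "nat set \<Rightarrow> ((nat \<Rightarrow> int extended) \<Rightarrow> bool) \<Rightarrow> bool" where
  "fo_definable V R \<longleftrightarrow> (\<exists>P. free_vars P = V \<and> (\<forall>x \<in> V \<rightarrow> carrier S. holds S P x \<longleftrightarrow> R x))"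

lemma fo_definableI:
  assumes "free_vars P = V" "\<And>x. x \<in> V \<rightarrow> carrier S \<Longrightarrow> holds S P x \<longleftrightarrow> R x"
  shows "fo_definable V R"
  using assms unfolding fo_definable_def by blast

lemma fo_definableE:
  assumes "fo_definable V R"
  obtains P where "free_vars P = V" "\<forall>x \<in> V \<rightarrow> carrier S. holds S P x \<longleftrightarrow> R x"
  using assms unfolding fo_definable_def by blast

lemma fo_definable_cong:
  assumes "fo_definable V R" "\<And>x. x \<in> V \<rightarrow> carrier S \<Longrightarrow> R x \<longleftrightarrow> R' x"
  shows "fo_definable V R'"
proof -
  obtain P where P: "free_vars P = V" "\<forall>x \<in> V \<rightarrow> carrier S. holds S P x \<longleftrightarrow> R x"
    using assms(1) by (rule fo_definableE)
  show ?thesis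
    by (rule fo_definableI[OF P(1)]) (use P(2) assms(2) in blast)
qed

lemma fo_definable_conj:
  assumes "fo_definable V R" "fo_definable V Q"
  shows "fo_definable V (\<lambda>x. R x \<and> Q x)"
proof -
  obtain P1 where P1: "free_vars P1 = V" "\<forall>x \<in> V \<rightarrow> carrier S. holds S P1 x \<longleftrightarrow> R x"
    using assms(1) by (rule fo_definableE)
  obtain P2 where P2: "free_vars P2 = V" "\<forall>x \<in> V \<rightarrow> carrier S. holds S P2 x \<longleftrightarrow> Q x"
    using assms(2) by (rule fo_definableE)
  show ?thesis
    by (rule fo_definableI[of "Conj P1 P2"]) (use P1 P2 in auto)
qed

lemma fo_definable_not:
  assumes "fo_definable V R"
  shows "fo_definable V (\<lambda>x. \<not> R x)"
proof -
  obtain P where P: "free_vars P = V" "\<forall>x \<in> V \<rightarrow> carrier S. holds S P x \<longleftrightarrow> R x"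
    using assms by (rule fo_definableE)
  show ?thesis
    by (rule fo_definableI[of "Neg P"]) (use P in auto)
qed

lemma fo_definable_disj:
  assumes "fo_definable V R" "fo_definable V Q"
  shows "fo_definable V (\<lambda>x. R x \<or> Q x)"
  using fo_definable_not[OF fo_definable_conj[OF assms[THEN fo_definable_not]]] by simp

lemma fo_definable_ex:
  assumes "fo_definable V R"
  shows "fo_definable (V - {i}) (\<lambda>x. \<exists>a\<in>carrier S. R (x(i := a)))"
proof -
  obtain P where P: "free_vars P = V" "\<forall>x \<in> V \<rightarrow> carrier S. holds S P x \<longleftrightarrow> R x"
    using assms by (rule fo_definableE)
  show ?thesis
  proof (rule fo_definableI[of "Ex i P"])
    fix x assume x: "x \<in> V - {i} \<rightarrow> carrier S"
    have "holds S P (x(i := a)) \<longleftrightarrow> R (x(i := a))" if "a \<in> carrier S" for a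
      by (rule bspec[OF P(2)]) (use x that in auto)
    then show "holds S (Ex i P) x \<longleftrightarrow> (\<exists>a\<in>carrier S. R (x(i := a)))"
      by simp
  qed (simp add: P(1))
qed

text \<open>The auxiliary variables have the indices directly after \<open>n\<close>: quantifying
  the last one leaves an interval again.\<close>

lemma fo_definable_exs:
  assumes "fo_definable {1..n + m} R"
  shows "fo_definable {1..n} (\<lambda>x. \<exists>z \<in> {n + 1..n + m} \<rightarrow> carrier S. R (override_on x z {n + 1..n + m}))"
  using assms
proof (induction m arbitrary: R)
  case 0
  then show ?case by simp
next
  case (Suc m)
  have int: "{n + 1..n + Suc m} = insert (Suc (n + m)) {n + 1..n + m}" "{1..n + Suc m} - {Suc (n + m)} = {1..n + m}"
    by auto
  have "fo_definable {1..n + m} (\<lambda>x. \<exists>a\<in>carrier S. R (x(Suc (n + m) := a)))"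
    using fo_definable_ex[OF Suc.prems, of "Suc (n + m)"] unfolding int .
  then have "fo_definable {1..n} (\<lambda>x. \<exists>z \<in> {n + 1..n + m} \<rightarrow> carrier S.
      \<exists>a\<in>carrier S. R ((override_on x z {n + 1..n + m})(Suc (n + m) := a)))"
    by (rule Suc.IH)
  then show ?case
  proof (rule fo_definable_cong)
    fix x :: "nat \<Rightarrow> int extended"
    have eq: "(override_on x z {n + 1..n + m})(Suc (n + m) := a) =
      override_on x (z(Suc (n + m) := a)) {n + 1..n + Suc m}" for z :: "nat \<Rightarrow> int extended" and a
      by (auto simp: override_on_def fun_eq_iff)
    show "(\<exists>z \<in> {n + 1..n + m} \<rightarrow> carrier S. \<exists>a\<in>carrier S. R ((override_on x z {n + 1..n + m})(Suc (n + m) := a)))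
      \<longleftrightarrow> (\<exists>z \<in> {n + 1..n + Suc m} \<rightarrow> carrier S. R (override_on x z {n + 1..n + Suc m}))"
      unfolding eq
    proof (intro iffI; elim bexE)
      fix z a assume "z \<in> {n + 1..n + m} \<rightarrow> carrier S" "a \<in> carrier S"
        "R (override_on x (z(Suc (n + m) := a)) {n + 1..n + Suc m})"
      then show "\<exists>z \<in> {n + 1..n + Suc m} \<rightarrow> carrier S. R (override_on x z {n + 1..n + Suc m})"
        by (intro bexI[of _ "z(Suc (n + m) := a)"]) (auto simp: int(1))
    next
      fix z assume "z \<in> {n + 1..n + Suc m} \<rightarrow> carrier S" "R (override_on x z {n + 1..n + Suc m})"
      then show "\<exists>z \<in> {n + 1..n + m} \<rightarrow> carrier S. \<exists>a\<in>carrier S.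
          R (override_on x (z(Suc (n + m) := a)) {n + 1..n + Suc m})"
        by (intro bexI[of _ z] bexI[of _ "z (Suc (n + m))"]) (auto simp: int(1))
    qed
  qed
qed

section \<open>Constants and linear equations in the logic\<close>

text \<open>From here on relations use the usual order; where the natural order is the reverse, the
  two sides of the atom are exchanged.\<close>

lemma fo_definable_le:
  "fo_definable {1..n} (\<lambda>x. (\<Otimes>i\<in>{1..n}. x i [^] (k i :: nat)) \<le> (\<Otimes>i\<in>{1..n}. x i [^] (r i :: nat)))"
  using natural_le_eq
proof
  assume "natural_le S = (\<le>)"
  then show ?thesis
    by (intro fo_definableI[of "Atom n k r"]) simp_all
next
  assume "natural_le S = (\<ge>)"
  then show ?thesis
    by (intro fo_definableI[of "Atom n r k"]) simp_all
qed

text \<open>All other exponents are set to zero. With \<open>k = 0\<close> or \<open>r = 0\<close>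
  one side becomes the unit, the only constant at hand.\<close>

lemma fo_definable_pow_le:
  assumes "i \<in> {1..n}" "j \<in> {1..n}"
  shows "fo_definable {1..n} (\<lambda>x. x i [^] (k :: nat) \<le> x j [^] (r :: nat))"
proof -
  have single: "(\<Otimes>l\<in>{1..n}. x l [^] (if i = l then k else 0)) = x i [^] k"
    if "i \<in> {1..n}" "x \<in> {1..n} \<rightarrow> carrier S" for i and k :: nat and x
  proof -
    have x: "x l [^] k \<in> carrier S" if "l \<in> {1..n}" for l
      by (intro nat_pow_closed funcset_mem[OF \<open>x \<in> _\<close> that])
    have "(\<Otimes>l\<in>{1..n}. x l [^] (if i = l then k else 0)) = (\<Otimes>l\<in>{1..n}. if i = l then x l [^] k else \<one>)"
      by (rule finprod_cong') (use x in auto)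
    also have "\<dots> = x i [^] k"
      by (rule finprod_singleton) (use that(1) x in auto)
    finally show ?thesis .
  qed
  show ?thesis
  proof (rule fo_definable_cong[OF fo_definable_le[of n "\<lambda>l. if i = l then k else 0" "\<lambda>l. if j = l then r else 0"]])
    fix x assume x: "x \<in> {1..n} \<rightarrow> carrier S"
    show "(\<Otimes>l\<in>{1..n}. x l [^] (if i = l then k else 0)) \<le> (\<Otimes>l\<in>{1..n}. x l [^] (if j = l then r else 0))
        \<longleftrightarrow> x i [^] k \<le> x j [^] r"
      by (simp only: single[OF assms(1) x] single[OF assms(2) x])
  qed
qed

text \<open>With all exponents zero the atom compares the unit with itself, yet has all of
  \<open>{1..n}\<close> as free variables.\<close>

lemma fo_definable_const: "fo_definable {1..n} (\<lambda>_. c)"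
proof -
  have "fo_definable {1..n} (\<lambda>_. True)"
    using fo_definable_le[of n "\<lambda>_. 0" "\<lambda>_. 0"] by simp
  then show ?thesis
    using fo_definable_not[of "{1..n}" "\<lambda>_. True"] by (cases c) simp_all
qed

lemma fo_definable_ball:
  assumes "finite J" "\<And>j. j \<in> J \<Longrightarrow> fo_definable {1..n} (R j)"
  shows "fo_definable {1..n} (\<lambda>x. \<forall>j\<in>J. R j x)"
  using assms by (induction J) (simp_all add: fo_definable_const fo_definable_conj)

lemma fo_definable_bex:
  assumes "finite J" "\<And>j. j \<in> J \<Longrightarrow> fo_definable {1..n} (R j)"
  shows "fo_definable {1..n} (\<lambda>x. \<exists>j\<in>J. R j x)"
  using assms by (induction J) (simp_all add: fo_definable_const fo_definable_disj)

lemma pow_0_1: "x [^] (0 :: nat) = Fin 0" "x [^] (1 :: nat) = x"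
  unfolding nat_pow_eq by (cases x; simp add: ext_value_def)+

text \<open>The infinite elements are the idempotents other than the unit.\<close>

lemma fo_definable_is_Fin:
  assumes "i \<in> {1..n}"
  shows "fo_definable {1..n} (\<lambda>x. x i \<in> range Fin)"
proof -
  have "fo_definable {1..n} (\<lambda>x. \<not> ((x i [^] (2 :: nat) \<le> x i [^] (1 :: nat) \<and> x i [^] (1 :: nat) \<le> x i [^] (2 :: nat))
    \<and> \<not> (x i [^] (0 :: nat) \<le> x i [^] (1 :: nat) \<and> x i [^] (1 :: nat) \<le> x i [^] (0 :: nat))))"
    by (intro fo_definable_not fo_definable_conj fo_definable_pow_le assms)
  then show ?thesis
  proof (rule fo_definable_cong)
    fix x :: "nat \<Rightarrow> int extended"
    show "\<not> ((x i [^] (2 :: nat) \<le> x i [^] (1 :: nat) \<and> x i [^] (1 :: nat) \<le> x i [^] (2 :: nat))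
      \<and> \<not> (x i [^] (0 :: nat) \<le> x i [^] (1 :: nat) \<and> x i [^] (1 :: nat) \<le> x i [^] (0 :: nat)))
      \<longleftrightarrow> x i \<in> range Fin"
      by (cases "x i") (auto simp only: nat_pow_eq, auto simp: ext_value_def)
  qed
qed

text \<open>Comparison with the unit tells the two infinities apart.\<close>

lemma fo_definable_eq_infinity:
  assumes "i \<in> {1..n}"
  shows "fo_definable {1..n} (\<lambda>x. x i = Minf)" "fo_definable {1..n} (\<lambda>x. x i = Pinf)"
proof -
  have "fo_definable {1..n} (\<lambda>x. \<not> x i \<in> range Fin \<and> x i [^] (1 :: nat) \<le> x i [^] (0 :: nat))"
    by (intro fo_definable_not fo_definable_conj fo_definable_pow_le fo_definable_is_Fin assms)
  then show "fo_definable {1..n} (\<lambda>x. x i = Minf)"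
  proof (rule fo_definable_cong)
    fix x :: "nat \<Rightarrow> int extended"
    show "\<not> x i \<in> range Fin \<and> x i [^] (1 :: nat) \<le> x i [^] (0 :: nat) \<longleftrightarrow> x i = Minf"
      by (cases "x i") (auto simp only: nat_pow_eq, auto simp: ext_value_def)
  qed
  have "fo_definable {1..n} (\<lambda>x. \<not> x i \<in> range Fin \<and> x i [^] (0 :: nat) \<le> x i [^] (1 :: nat))"
    by (intro fo_definable_not fo_definable_conj fo_definable_pow_le fo_definable_is_Fin assms)
  then show "fo_definable {1..n} (\<lambda>x. x i = Pinf)"
  proof (rule fo_definable_cong)
    fix x :: "nat \<Rightarrow> int extended"
    show "\<not> x i \<in> range Fin \<and> x i [^] (0 :: nat) \<le> x i [^] (1 :: nat) \<longleftrightarrow> x i = Pinf"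
      by (cases "x i") (auto simp only: nat_pow_eq, auto simp: ext_value_def)
  qed
qed

text \<open>\<open>1\<close> is the least element above the unit \<open>0\<close>.\<close>

lemma fo_definable_eq_Fin_1:
  assumes "i \<in> {1..n}"
  shows "fo_definable {1..n} (\<lambda>x. x i = Fin 1)"
proof -
  \<comment> \<open>The variable \<open>n + 1\<close> holds a competitor: an element above the unit
    and strictly below \<open>x i\<close>.\<close>
  have i: "i \<in> {1..n + 1}" "n + 1 \<in> {1..n + 1}" "i \<noteq> n + 1"
    using assms by auto
  have gt: "fo_definable {1..n + 1} (\<lambda>x. \<not> x j [^] (1 :: nat) \<le> x j [^] (0 :: nat))" if "j \<in> {1..n + 1}" for j
    by (intro fo_definable_not fo_definable_pow_le that)
  have "fo_definable {1..n + 1} (\<lambda>x. \<not> x (n + 1) [^] (1 :: nat) \<le> x (n + 1) [^] (0 :: nat)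
      \<and> \<not> x i [^] (1 :: nat) \<le> x (n + 1) [^] (1 :: nat))"
    by (intro fo_definable_conj gt fo_definable_not fo_definable_pow_le i)
  then have "fo_definable ({1..n + 1} - {n + 1}) (\<lambda>x. \<exists>a\<in>carrier S. (\<lambda>x. \<not> x (n + 1) [^] (1 :: nat) \<le> x (n + 1) [^] (0 :: nat)
      \<and> \<not> x i [^] (1 :: nat) \<le> x (n + 1) [^] (1 :: nat)) (x(n + 1 := a)))"
    by (rule fo_definable_ex)
  moreover have "{1..n + 1} - {n + 1} = {1..n}"
    by auto
  ultimately have "fo_definable {1..n} (\<lambda>x. \<exists>a\<in>carrier S. \<not> a [^] (1 :: nat) \<le> a [^] (0 :: nat)
      \<and> \<not> x i [^] (1 :: nat) \<le> a [^] (1 :: nat))"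
    using i(3) by simp
  then have "fo_definable {1..n} (\<lambda>x. \<not> x i [^] (1 :: nat) \<le> x i [^] (0 :: nat) \<and>
      \<not> (\<exists>a\<in>carrier S. \<not> a [^] (1 :: nat) \<le> a [^] (0 :: nat) \<and> \<not> x i [^] (1 :: nat) \<le> a [^] (1 :: nat)))"
    by (intro fo_definable_conj fo_definable_not fo_definable_pow_le assms)
  then show ?thesis
  proof (rule fo_definable_cong)
    fix x :: "nat \<Rightarrow> int extended"
    have 1: "Fin 1 \<in> carrier S"
      using A by (auto simp: Fin_in_carrier)
    have "(\<not> x i \<le> Fin 0 \<and> \<not> (\<exists>a\<in>carrier S. \<not> a \<le> Fin 0 \<and> \<not> x i \<le> a)) \<longleftrightarrow> x i = Fin 1"
    proof
      assume *: "\<not> x i \<le> Fin 0 \<and> \<not> (\<exists>a\<in>carrier S. \<not> a \<le> Fin 0 \<and> \<not> x i \<le> a)"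
      then have "x i \<le> Fin 1"
        using 1 by auto
      with * show "x i = Fin 1"
        by (cases "x i") auto
    next
      assume "x i = Fin 1"
      moreover have "Fin 1 \<le> a" if "\<not> a \<le> Fin 0" for a :: "int extended"
        using that by (cases a) auto
      ultimately show "\<not> x i \<le> Fin 0 \<and> \<not> (\<exists>a\<in>carrier S. \<not> a \<le> Fin 0 \<and> \<not> x i \<le> a)"
        by auto
    qed
    then show "(\<not> x i [^] (1 :: nat) \<le> x i [^] (0 :: nat) \<and>
      \<not> (\<exists>a\<in>carrier S. \<not> a [^] (1 :: nat) \<le> a [^] (0 :: nat) \<and> \<not> x i [^] (1 :: nat) \<le> a [^] (1 :: nat)))
      \<longleftrightarrow> x i = Fin 1"
      unfolding pow_0_1 .
  qed
qed

text \<open>Exponents cannot be negative, so positive and negative coefficients go to opposite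
  sides, and equality is two inequalities. The guard excludes infinite values, which
  \<open>fin_part\<close> would count as 0.\<close>

lemma fo_definable_linear:
  "fo_definable {1..n} (\<lambda>x. (\<forall>i\<in>{1..n}. w i \<noteq> 0 \<longrightarrow> x i \<in> range Fin) \<and> (\<Sum>i\<in>{1..n}. w i * fin_part (x i)) = 0)"
proof -
  let ?k = "\<lambda>i. nat (w i)" and ?r = "\<lambda>i. nat (- w i)"
  have "fo_definable {1..n} (\<lambda>x. (\<forall>i\<in>{1..n}. w i \<noteq> 0 \<longrightarrow> x i \<in> range Fin) \<and>
      (\<Otimes>i\<in>{1..n}. x i [^] ?k i) \<le> (\<Otimes>i\<in>{1..n}. x i [^] ?r i) \<and>
      (\<Otimes>i\<in>{1..n}. x i [^] ?r i) \<le> (\<Otimes>i\<in>{1..n}. x i [^] ?k i))"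
  proof (intro fo_definable_conj fo_definable_le fo_definable_ball)
    show "fo_definable {1..n} (\<lambda>x. w i \<noteq> 0 \<longrightarrow> x i \<in> range Fin)" if "i \<in> {1..n}" for i
      by (cases "w i = 0") (simp_all add: fo_definable_const fo_definable_is_Fin that del: atLeastAtMost_iff)
  qed simp
  then show ?thesis
  proof (rule fo_definable_cong)
    fix x assume x: "x \<in> {1..n} \<rightarrow> carrier S"
    have prod: "(\<Otimes>i\<in>{1..n}. x i [^] k i) = Fin (\<Sum>i\<in>{1..n}. int (k i) * fin_part (x i))"
      if f: "\<forall>i\<in>{1..n}. w i \<noteq> 0 \<longrightarrow> x i \<in> range Fin" and k: "\<And>i. w i = 0 \<Longrightarrow> k i = 0" for k :: "nat \<Rightarrow> nat"
    proof -
      have "x i \<noteq> Minf \<and> x i \<noteq> Pinf" if "i \<in> {1..n}" "k i \<noteq> 0" for i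
        using f k[of i] that by fastforce
      then have "\<not> (\<exists>i\<in>{1..n}. k i \<noteq> 0 \<and> x i = Minf)" "\<not> (\<exists>i\<in>{1..n}. k i \<noteq> 0 \<and> x i = Pinf)"
        by blast+
      moreover have "(\<Otimes>i\<in>{1..n}. x i [^] k i) = ext_value (\<exists>i\<in>{1..n}. k i \<noteq> 0 \<and> x i = Minf)
          (\<exists>i\<in>{1..n}. k i \<noteq> 0 \<and> x i = Pinf) (\<Sum>i\<in>{1..n}. int (k i) * fin_part (x i))"
        by (rule finprod_eq) (use x in auto)
      ultimately show ?thesis
        by (simp only: ext_value_def if_False)
    qed
    have "(\<Sum>i\<in>{1..n}. w i * fin_part (x i)) =
        (\<Sum>i\<in>{1..n}. int (?k i) * fin_part (x i)) - (\<Sum>i\<in>{1..n}. int (?r i) * fin_part (x i))"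
      unfolding sum_subtractf[symmetric] by (rule sum.cong) auto
    then show "((\<forall>i\<in>{1..n}. w i \<noteq> 0 \<longrightarrow> x i \<in> range Fin) \<and>
      (\<Otimes>i\<in>{1..n}. x i [^] ?k i) \<le> (\<Otimes>i\<in>{1..n}. x i [^] ?r i) \<and>
      (\<Otimes>i\<in>{1..n}. x i [^] ?r i) \<le> (\<Otimes>i\<in>{1..n}. x i [^] ?k i)) \<longleftrightarrow>
      (\<forall>i\<in>{1..n}. w i \<noteq> 0 \<longrightarrow> x i \<in> range Fin) \<and> (\<Sum>i\<in>{1..n}. w i * fin_part (x i)) = 0"
      using prod[of ?k] prod[of ?r] by auto
  qed
qed

lemma definable_if_fo_definable:
  assumes "fo_definable {1..n} R"
  shows "definable S n {x \<in> carrier (power_monoid S n). R x}"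
proof -
  obtain P where P: "free_vars P = {1..n}" "\<forall>x \<in> {1..n} \<rightarrow> carrier S. holds S P x \<longleftrightarrow> R x"
    using assms by (rule fo_definableE)
  have "holds S P x \<longleftrightarrow> R x" if "x \<in> carrier (power_monoid S n)" for x
    using P(2) that by (auto simp: carrier_power_monoid)
  then show ?thesis
    unfolding definable_def by (intro exI[of _ P]) (auto simp: P(1))
qed

text \<open>All exponents are positive here, so that the infinite components do not depend on them.\<close>

lemma fo_definable_positive_combination:
  assumes J: "finite J" "\<And>f i. f \<in> J \<Longrightarrow> i \<in> {1..n} \<Longrightarrow> f i \<in> carrier S"
  shows "fo_definable {1..n} (\<lambda>x. \<exists>k. (\<forall>f\<in>J. k f \<noteq> 0) \<and>
    (\<forall>i\<in>{1..n}. x i = ext_plus (b i) (\<Otimes>f\<in>J. f i [^] (k f :: nat))))"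
proof -
  \<comment> \<open>Enumerating \<open>J\<close> turns the exponents \<open>k f\<close> into
    variables with consecutive indices.\<close>
  obtain g where g: "bij_betw g {1..card J} J"
    using J(1) ex_bij_betw_nat_finite_1 by blast
  define m where "m = card J"
  define mi where "mi i \<longleftrightarrow> b i = Minf \<or> (\<exists>f\<in>J. f i = Minf)" for i
  define pi where "pi i \<longleftrightarrow> b i = Pinf \<or> (\<exists>f\<in>J. f i = Pinf)" for i
  define \<beta> where "\<beta> i = fin_part (b i)" for i
  define \<phi> where "\<phi> j i = fin_part (g j i)" for i j
  define val where "val i \<kappa> = \<beta> i + (\<Sum>j\<in>{1..m}. int (\<kappa> j) * \<phi> j i)" for i \<kappa>
  have val: "ext_plus (b i) (\<Otimes>f\<in>J. f i [^] k f) = ext_value (mi i) (pi i) (val i (k \<circ> g))"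
    if "i \<in> {1..n}" "\<forall>f\<in>J. k f \<noteq> 0" for i and k :: "(nat \<Rightarrow> int extended) \<Rightarrow> nat"
  proof -
    have "(\<Otimes>f\<in>J. f i [^] k f) = ext_value (\<exists>f\<in>J. k f \<noteq> 0 \<and> f i = Minf) (\<exists>f\<in>J. k f \<noteq> 0 \<and> f i = Pinf)
        (\<Sum>f\<in>J. int (k f) * fin_part (f i))"
      using finprod_eq[OF J(1), of "\<lambda>f. f i" k] J(2) that(1) by blast
    also have "(\<Sum>f\<in>J. int (k f) * fin_part (f i)) = (\<Sum>j\<in>{1..m}. int ((k \<circ> g) j) * \<phi> j i)"
      using sum.reindex_bij_betw[OF g, of "\<lambda>f. int (k f) * fin_part (f i)"] by (simp add: m_def \<phi>_def)
    also have "(\<exists>f\<in>J. k f \<noteq> 0 \<and> f i = Minf) \<longleftrightarrow> (\<exists>f\<in>J. f i = Minf)"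
      using that(2) by auto
    also have "(\<exists>f\<in>J. k f \<noteq> 0 \<and> f i = Pinf) \<longleftrightarrow> (\<exists>f\<in>J. f i = Pinf)"
      using that(2) by auto
    finally have eq: "(\<Otimes>f\<in>J. f i [^] k f) = ext_value (\<exists>f\<in>J. f i = Minf) (\<exists>f\<in>J. f i = Pinf)
        (\<Sum>j\<in>{1..m}. int ((k \<circ> g) j) * \<phi> j i)" .
    have "ext_value (b i = Minf) (b i = Pinf) (\<beta> i) = b i"
      by (cases "b i") (simp_all add: ext_value_def \<beta>_def)
    from ext_value_plus[of "b i = Minf" "b i = Pinf" "\<beta> i", unfolded this] show ?thesis
      unfolding mi_def pi_def val_def eq .
  qed
  \<comment> \<open>Variables: the \<open>n\<close> given ones, one held at \<open>Fin 1\<close>,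
    and \<open>m\<close> exponents.\<close>
  define N where "N = n + (m + 1)"
  \<comment> \<open>The coefficients of \<open>x i\<close> minus \<beta> i minus the sum of \<kappa>
    j times \<phi> j i; the variable \<open>n + 1\<close>, equal to 1, carries the constant \<beta>
    i.\<close>
  define w where "w i l = (if l = i then 1 else if l = n + 1 then - \<beta> i else if l \<in> {n + 2..N} then - \<phi> (l - (n + 1)) i else 0)"
    for i l
  define E where "E i z \<longleftrightarrow> (if mi i then z i = Minf else if pi i then z i = Pinf
      else (\<forall>l\<in>{1..N}. w i l \<noteq> 0 \<longrightarrow> z l \<in> range Fin) \<and> (\<Sum>l\<in>{1..N}. w i l * fin_part (z l)) = 0)"
    for i and z :: "nat \<Rightarrow> int extended"
  \<comment> \<open>Variable \<open>n + 1\<close> also serves to say that each exponent is at least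
    1; finiteness rules out \<infinity>, which would pass that comparison.\<close>
  define R where "R z \<longleftrightarrow> z (n + 1) = Fin 1 \<and>
      (\<forall>l\<in>{n + 2..N}. z l \<in> range Fin \<and> z (n + 1) [^] (1 :: nat) \<le> z l [^] (1 :: nat)) \<and> (\<forall>i\<in>{1..n}. E i z)" for z
  have "fo_definable {1..N} R"
    unfolding R_def
  proof (intro fo_definable_conj fo_definable_ball fo_definable_is_Fin fo_definable_eq_Fin_1 fo_definable_pow_le)
    show "fo_definable {1..N} (E i)" if "i \<in> {1..n}" for i
    proof -
      have "i \<in> {1..N}" using that by (auto simp: N_def)
      then show ?thesis
        unfolding E_def
        by (cases "mi i"; cases "pi i") (simp_all only: if_True if_False fo_definable_eq_infinity fo_definable_linear)
    qed
  qed (auto simp: N_def)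
  then have "fo_definable {1..n} (\<lambda>x. \<exists>z \<in> {n + 1..N} \<rightarrow> carrier S. R (override_on x z {n + 1..N}))"
    unfolding N_def by (rule fo_definable_exs)
  then show ?thesis
  proof (rule fo_definable_cong)
    fix x assume x: "x \<in> {1..n} \<rightarrow> carrier S"
    have E: "E i (override_on x z {n + 1..N}) \<longleftrightarrow> x i = ext_value (mi i) (pi i) (val i \<kappa>)"
      if i: "i \<in> {1..n}" and z: "z (n + 1) = Fin 1" "\<And>j. j \<in> {1..m} \<Longrightarrow> z (n + 1 + j) = Fin (int (\<kappa> j))" for i z \<kappa>
    proof -
      let ?o = "override_on x z {n + 1..N}"
      have o: "?o i = x i" "?o (n + 1) = Fin 1" "\<And>j. j \<in> {1..m} \<Longrightarrow> ?o (n + 1 + j) = Fin (int (\<kappa> j))"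
        using i z by (auto simp: override_on_def N_def)
      have fin: "(\<forall>l\<in>{1..N}. w i l \<noteq> 0 \<longrightarrow> ?o l \<in> range Fin) \<longleftrightarrow> x i \<in> range Fin"
      proof
        assume *: "\<forall>l\<in>{1..N}. w i l \<noteq> 0 \<longrightarrow> ?o l \<in> range Fin"
        have "i \<in> {1..N}" "w i i \<noteq> 0"
          using i by (simp_all add: w_def N_def)
        then have "?o i \<in> range Fin"
          using * by blast
        then show "x i \<in> range Fin" unfolding o(1) .
      next
        assume xi: "x i \<in> range Fin"
        show "\<forall>l\<in>{1..N}. w i l \<noteq> 0 \<longrightarrow> ?o l \<in> range Fin"
        proof (intro ballI impI)
          fix l assume l: "l \<in> {1..N}" "w i l \<noteq> 0"
          then consider "l = i" | "l = n + 1" | "l \<in> {n + 2..N}"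
            by (auto simp: w_def split: if_splits)
          then show "?o l \<in> range Fin"
          proof cases
            case 3
            then have "l - (n + 1) \<in> {1..m}" and l: "n + 1 + (l - (n + 1)) = l"
              by (auto simp: N_def)
            from o(3)[OF this(1)] show ?thesis
              unfolding l by simp
          qed (use xi o in auto)
        qed
      qed
      have "(\<Sum>l\<in>{1..N}. w i l * fin_part (?o l)) = (\<Sum>l\<in>{i} \<union> ({n + 1} \<union> {n + 2..N}). w i l * fin_part (?o l))"
        by (rule sum.mono_neutral_right) (use i in \<open>auto simp: w_def N_def\<close>)
      also have "\<dots> = w i i * fin_part (?o i) + (w i (n + 1) * fin_part (?o (n + 1)) + (\<Sum>l\<in>{n + 2..N}. w i l * fin_part (?o l)))"
        using i by (subst sum.union_disjoint; simp)+
      also have "(\<Sum>l\<in>{n + 2..N}. w i l * fin_part (?o l)) = (\<Sum>j\<in>{1..m}. w i (n + 1 + j) * fin_part (?o (n + 1 + j)))"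
        by (rule sum.reindex_bij_witness[of _ "\<lambda>j. n + 1 + j" "\<lambda>l. l - (n + 1)"]) (auto simp: N_def)
      also have "\<dots> = (\<Sum>j\<in>{1..m}. - (int (\<kappa> j) * \<phi> j i))"
      proof (rule sum.cong)
        fix j assume j: "j \<in> {1..m}"
        have w: "w i (n + 1 + j) = - \<phi> j i"
          using i j by (simp add: w_def N_def)
        show "w i (n + 1 + j) * fin_part (?o (n + 1 + j)) = - (int (\<kappa> j) * \<phi> j i)"
          unfolding o(3)[OF j] w by simp
      qed simp
      also have "w i i * fin_part (?o i) + (w i (n + 1) * fin_part (?o (n + 1)) + (\<Sum>j\<in>{1..m}. - (int (\<kappa> j) * \<phi> j i)))
          = fin_part (x i) - val i \<kappa>"
        using i unfolding o(1,2) by (simp add: w_def val_def sum_negf)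
      finally have sum: "(\<Sum>l\<in>{1..N}. w i l * fin_part (?o l)) = fin_part (x i) - val i \<kappa>" .
      have "x i \<in> range Fin \<and> fin_part (x i) = val i \<kappa> \<longleftrightarrow> x i = Fin (val i \<kappa>)"
        by (cases "x i") auto
      then show ?thesis
        unfolding E_def fin sum o(1) ext_value_def by simp
    qed
    show "(\<exists>z \<in> {n + 1..N} \<rightarrow> carrier S. R (override_on x z {n + 1..N})) \<longleftrightarrow>
      (\<exists>k. (\<forall>f\<in>J. k f \<noteq> 0) \<and> (\<forall>i\<in>{1..n}. x i = ext_plus (b i) (\<Otimes>f\<in>J. f i [^] (k f :: nat))))"
    proof
      assume "\<exists>z \<in> {n + 1..N} \<rightarrow> carrier S. R (override_on x z {n + 1..N})"
      then obtain z where z: "z \<in> {n + 1..N} \<rightarrow> carrier S" "R (override_on x z {n + 1..N})"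
        by blast
      have z1: "z (n + 1) = Fin 1"
        using z(2) by (simp add: R_def N_def override_on_def)
      define \<kappa> where "\<kappa> j = nat (fin_part (z (n + 1 + j)))" for j
      have zj: "z (n + 1 + j) = Fin (int (\<kappa> j)) \<and> \<kappa> j \<noteq> 0" if "j \<in> {1..m}" for j
      proof -
        have l: "n + 1 + j \<in> {n + 2..N}" "n + 1 + j \<in> {n + 1..N}" "n + 1 \<in> {n + 1..N}"
          using that by (auto simp: N_def)
        have "z (n + 1 + j) \<in> range Fin" "z (n + 1) [^] (1 :: nat) \<le> z (n + 1 + j) [^] (1 :: nat)"
          using z(2) l unfolding R_def by (metis override_on_apply_in)+
        then show ?thesis
          unfolding pow_0_1 by (auto simp: z1 \<kappa>_def)
      qed
      \<comment> \<open>Carries the exponents back from indices to the elements of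
        \<open>J\<close>.\<close>
      define k where "k f = \<kappa> (inv_into {1..m} g f)" for f
      have kg: "(k \<circ> g) j = \<kappa> j" if "j \<in> {1..m}" for j
        using g that by (simp add: k_def m_def bij_betw_def inv_into_f_f)
      have k: "\<forall>f\<in>J. k f \<noteq> 0"
        using g zj unfolding k_def m_def by (metis bij_betw_def inv_into_into)
      have "x i = ext_plus (b i) (\<Otimes>f\<in>J. f i [^] k f)" if "i \<in> {1..n}" for i
      proof -
        have "val i (k \<circ> g) = val i \<kappa>"
          unfolding val_def using kg by (intro arg_cong2[of _ _ _ _ "(+)"] sum.cong) auto
        moreover have "E i (override_on x z {n + 1..N})"
          using z(2) that unfolding R_def by blast
        ultimately show ?thesis
          using E[of i z \<kappa>, OF that z1] zj val[OF that k] by simp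
      qed
      with k show "\<exists>k. (\<forall>f\<in>J. k f \<noteq> 0) \<and> (\<forall>i\<in>{1..n}. x i = ext_plus (b i) (\<Otimes>f\<in>J. f i [^] (k f :: nat)))"
        by blast
    next
      assume "\<exists>k. (\<forall>f\<in>J. k f \<noteq> 0) \<and> (\<forall>i\<in>{1..n}. x i = ext_plus (b i) (\<Otimes>f\<in>J. f i [^] (k f :: nat)))"
      then obtain k :: "(nat \<Rightarrow> int extended) \<Rightarrow> nat" where k: "\<forall>f\<in>J. k f \<noteq> 0"
        "\<And>i. i \<in> {1..n} \<Longrightarrow> x i = ext_plus (b i) (\<Otimes>f\<in>J. f i [^] k f)"
        by blast
      define z where "z l = (if l = n + 1 then Fin 1 else Fin (int (k (g (l - (n + 1))))))" for l
      have nonneg: "Fin (int a) \<in> carrier S" for a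
        using A by (auto simp: Fin_in_carrier)
      have z_closed: "z l \<in> carrier S" for l
        using nonneg[of 1] nonneg by (simp add: z_def)
      have z1: "z (n + 1) = Fin 1" and zj: "\<And>j. j \<in> {1..m} \<Longrightarrow> z (n + 1 + j) = Fin (int ((k \<circ> g) j))"
        by (auto simp: z_def)
      have "E i (override_on x z {n + 1..N})" if "i \<in> {1..n}" for i
        using E[of i z "k \<circ> g", OF that z1 zj] k(2)[OF that] val[OF that k(1)] by simp
      moreover have "z l \<in> range Fin \<and> z (n + 1) [^] (1 :: nat) \<le> z l [^] (1 :: nat)" if "l \<in> {n + 2..N}" for l
      proof -
        have "l - (n + 1) \<in> {1..card J}"
          using that by (auto simp: N_def m_def)
        then have "k (g (l - (n + 1))) \<noteq> 0"
          using k(1) bij_betwE[OF g] by blast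
        then have "z l = Fin (int (k (g (l - (n + 1)))))" "1 \<le> int (k (g (l - (n + 1))))"
          using that by (auto simp: z_def)
        then show ?thesis
          unfolding pow_0_1 z1 by simp
      qed
      ultimately have "R (override_on x z {n + 1..N})"
        unfolding R_def by (auto simp: override_on_def N_def z1)
      then show "\<exists>z \<in> {n + 1..N} \<rightarrow> carrier S. R (override_on x z {n + 1..N})"
        using z_closed by blast
    qed
  qed
qed

text \<open>A rational set is semilinear, and the exponent vectors of a linear set are sorted by
  their support \<open>J\<close>. \<open>restrict\<close> reconciles arbitrary assignments with
  elements of the power monoid.\<close>

lemma definable_if_rational:
  assumes "rational (power_monoid S n) D"
  shows "definable S n D"
proof -
  let ?G = "power_monoid S n"
  interpret G: comm_monoid ?G
    by (rule comm_monoid_power_monoid) (rule comm_monoid_axioms)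
  have pow: "(f [^]\<^bsub>?G\<^esub> (k :: nat)) i = f i [^] k" if "i \<in> {1..n}" for f k i
    using that by (induction k) (simp_all add: one_power_monoid mult_power_monoid one_eq mult_eq)
  have fin_comp: "(\<Otimes>\<^bsub>?G\<^esub>f\<in>F. f [^]\<^bsub>?G\<^esub> (k f :: nat)) i = (\<Otimes>f\<in>F. f i [^] k f)"
    if i: "i \<in> {1..n}" and F: "finite F" "F \<subseteq> carrier ?G" for i F k
    using F
  proof (induction F)
    case empty
    then show ?case using i by (simp add: one_power_monoid one_eq)
  next
    case (insert f F)
    have f: "f \<in> carrier ?G" "F \<subseteq> carrier ?G"
      using insert.prems by auto
    have comp: "f i \<in> carrier S" if "f \<in> carrier ?G" for f
      using that i unfolding carrier_power_monoid by (rule PiE_mem)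
    have "(\<Otimes>\<^bsub>?G\<^esub>f\<in>insert f F. f [^]\<^bsub>?G\<^esub> k f) = f [^]\<^bsub>?G\<^esub> k f \<otimes>\<^bsub>?G\<^esub> (\<Otimes>\<^bsub>?G\<^esub>f\<in>F. f [^]\<^bsub>?G\<^esub> k f)"
      using insert.hyps f by (intro G.finprod_insert) auto
    moreover have "(\<Otimes>f\<in>insert f F. f i [^] k f) = f i [^] k f \<otimes> (\<Otimes>f\<in>F. f i [^] k f)"
      using insert.hyps f comp by (intro finprod_insert) auto
    ultimately show ?case
      using insert.IH[OF f(2)] i by (simp add: mult_power_monoid pow mult_eq)
  qed
  have supp: "(\<Otimes>f\<in>F. f i [^] (if f \<in> J then k f else 0)) = (\<Otimes>f\<in>J. f i [^] (k f :: nat))"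
    if "finite F" "\<And>f. f \<in> F \<Longrightarrow> f i \<in> carrier S" "J \<subseteq> F" for i k J and F :: "(nat \<Rightarrow> int extended) set"
    by (rule finprod_mono_neutral_cong_right) (use that in auto)
  have "fo_definable {1..n} (\<lambda>x. restrict x {1..n} \<in> D)"
    using G.semilinear_if_rational[OF assms]
  proof (induction)
    case empty
    then show ?case by (simp add: fo_definable_const)
  next
    case (linear b F U)
    have F: "f i \<in> carrier S" if "f \<in> F" "i \<in> {1..n}" for f i
      using subsetD[OF linear.hyps(3) that(1)] that(2) unfolding carrier_power_monoid by (rule PiE_mem)
    have "fo_definable {1..n} (\<lambda>x. \<exists>J\<in>Pow F. \<exists>k. (\<forall>f\<in>J. k f \<noteq> 0) \<and>
        (\<forall>i\<in>{1..n}. x i = ext_plus (b i) (\<Otimes>f\<in>J. f i [^] (k f :: nat))))"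
    proof (rule fo_definable_bex)
      show "finite (Pow F)" using linear.hyps(2) by simp
      show "fo_definable {1..n} (\<lambda>x. \<exists>k. (\<forall>f\<in>J. k f \<noteq> 0) \<and>
        (\<forall>i\<in>{1..n}. x i = ext_plus (b i) (\<Otimes>f\<in>J. f i [^] (k f :: nat))))" if "J \<in> Pow F" for J
        by (rule fo_definable_positive_combination) (use that F finite_subset[OF _ linear.hyps(2)] in blast)+
    qed
    then have "fo_definable {1..n} (\<lambda>x. restrict x {1..n} \<in> {b} <#>\<^bsub>?G\<^esub> set_star ?G F)"
    proof (rule fo_definable_cong)
      fix x
      have eq: "restrict x {1..n} = b \<otimes>\<^bsub>?G\<^esub> y \<longleftrightarrow> (\<forall>i\<in>{1..n}. x i = ext_plus (b i) (y i))" for y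
        unfolding mult_power_monoid by (auto simp: restrict_def fun_eq_iff)
      have "restrict x {1..n} \<in> {b} <#>\<^bsub>?G\<^esub> set_star ?G F \<longleftrightarrow>
          (\<exists>k. restrict x {1..n} = b \<otimes>\<^bsub>?G\<^esub> (\<Otimes>\<^bsub>?G\<^esub>f\<in>F. f [^]\<^bsub>?G\<^esub> (k f :: nat)))"
        unfolding G.set_star_eq_finprod[OF linear.hyps(2,3)] set_mult_def by auto
      also have "\<dots> \<longleftrightarrow> (\<exists>k. \<forall>i\<in>{1..n}. x i = ext_plus (b i) (\<Otimes>f\<in>F. f i [^] (k f :: nat)))"
        by (simp only: eq fin_comp[OF _ linear.hyps(2,3)] cong: ball_cong)
      also have "\<dots> \<longleftrightarrow> (\<exists>J\<in>Pow F. \<exists>k. (\<forall>f\<in>J. k f \<noteq> 0) \<and>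
          (\<forall>i\<in>{1..n}. x i = ext_plus (b i) (\<Otimes>f\<in>J. f i [^] (k f :: nat))))"
      proof
        assume "\<exists>k. \<forall>i\<in>{1..n}. x i = ext_plus (b i) (\<Otimes>f\<in>F. f i [^] (k f :: nat))"
        then obtain k :: "(nat \<Rightarrow> int extended) \<Rightarrow> nat"
          where k: "\<forall>i\<in>{1..n}. x i = ext_plus (b i) (\<Otimes>f\<in>F. f i [^] k f)"
          by blast
        \<comment> \<open>A zero exponent contributes the unit even for an infinite factor, so only
          the support of \<open>k\<close> matters.\<close>
        let ?J = "{f \<in> F. k f \<noteq> 0}"
        have "(\<Otimes>f\<in>F. f i [^] k f) = (\<Otimes>f\<in>?J. f i [^] k f)" if "i \<in> {1..n}" for i
          by (rule finprod_mono_neutral_cong_right) (use linear.hyps(2) F[OF _ that] in auto)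
        with k show "\<exists>J\<in>Pow F. \<exists>k. (\<forall>f\<in>J. k f \<noteq> 0) \<and>
            (\<forall>i\<in>{1..n}. x i = ext_plus (b i) (\<Otimes>f\<in>J. f i [^] (k f :: nat)))"
          by (intro bexI[of _ ?J] exI[of _ k]) auto
      next
        assume "\<exists>J\<in>Pow F. \<exists>k. (\<forall>f\<in>J. k f \<noteq> 0) \<and>
          (\<forall>i\<in>{1..n}. x i = ext_plus (b i) (\<Otimes>f\<in>J. f i [^] (k f :: nat)))"
        then obtain J and k :: "(nat \<Rightarrow> int extended) \<Rightarrow> nat" where k: "J \<subseteq> F"
          "\<forall>i\<in>{1..n}. x i = ext_plus (b i) (\<Otimes>f\<in>J. f i [^] k f)"
          by blast
        have "(\<Otimes>f\<in>F. f i [^] (if f \<in> J then k f else 0)) = (\<Otimes>f\<in>J. f i [^] k f)" if "i \<in> {1..n}" for i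
          by (rule supp) (use linear.hyps(2) F[OF _ that] k(1) in auto)
        with k(2) show "\<exists>k. \<forall>i\<in>{1..n}. x i = ext_plus (b i) (\<Otimes>f\<in>F. f i [^] (k f :: nat))"
          by (intro exI[of _ "\<lambda>f. if f \<in> J then k f else 0"]) simp
      qed
      finally show "(\<exists>J\<in>Pow F. \<exists>k. (\<forall>f\<in>J. k f \<noteq> 0) \<and>
          (\<forall>i\<in>{1..n}. x i = ext_plus (b i) (\<Otimes>f\<in>J. f i [^] (k f :: nat)))) \<longleftrightarrow>
          restrict x {1..n} \<in> {b} <#>\<^bsub>?G\<^esub> set_star ?G F"
        by (rule sym)
    qed
    from fo_definable_disj[OF this linear.IH] show ?case
      by (simp only: Un_iff)
  qed
  then have "definable S n {x \<in> carrier ?G. restrict x {1..n} \<in> D}"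
    by (rule definable_if_fo_definable)
  moreover have "{x \<in> carrier ?G. restrict x {1..n} \<in> D} = D"
    using G.rational_closed[OF assms] by (auto simp: carrier_power_monoid PiE_restrict)
  ultimately show ?thesis by simp
qed

lemma presburger_property: "presburger_property S"
  unfolding presburger_property_def using rational_if_definable definable_if_rational by blast

end

section \<open>The five semirings\<close>

text \<open>On a chain, distributivity over \<open>max\<close> amounts to monotonicity of
  \<open>ext_plus\<close>.\<close>

lemma idempotent_comm_semiring_max:
  assumes "comm_monoid (max_semiring C)" "Minf \<in> C"
  shows "idempotent_comm_semiring (max_semiring C)"
proof -
  interpret comm_monoid "max_semiring C" by fact
  have closed: "x \<in> C \<Longrightarrow> y \<in> C \<Longrightarrow> max x y \<in> C" for x y
    by (simp add: max_def)
  have distrib: "ext_plus (max x y) z = max (ext_plus x z) (ext_plus y z)"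
    "ext_plus z (max x y) = max (ext_plus z x) (ext_plus z y)" for x y z
    by (cases x; cases y; cases z; simp)+
  show ?thesis
    by unfold_locales (simp_all add: max_semiring_def closed distrib assms(2) max.assoc, simp_all add: max.commute)
qed

text \<open>\<open>Minf \<notin> C\<close> makes \<open>Pinf\<close> absorbing, as the zero must be:
  \<open>ext_plus Minf Pinf\<close> is \<open>Minf\<close>.\<close>

lemma idempotent_comm_semiring_min:
  assumes "comm_monoid (min_semiring C)" "Pinf \<in> C" "Minf \<notin> C"
  shows "idempotent_comm_semiring (min_semiring C)"
proof -
  interpret comm_monoid "min_semiring C" by fact
  have closed: "x \<in> C \<Longrightarrow> y \<in> C \<Longrightarrow> min x y \<in> C" for x y
    by (simp add: min_def)
  have distrib: "ext_plus (min x y) z = min (ext_plus x z) (ext_plus y z)"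
    "ext_plus z (min x y) = min (ext_plus z x) (ext_plus z y)" for x y z
    by (cases x; cases y; cases z; simp)+
  have null: "ext_plus x Pinf = Pinf" "ext_plus Pinf x = Pinf" if "x \<in> C" for x
    using that assms(3) by (cases x; auto)+
  show ?thesis
    by unfold_locales (simp_all add: min_semiring_def closed distrib null assms(2) min.assoc, simp_all add: min.commute)
qed

lemma max_semiring_presburger:
  assumes fin: "A = UNIV \<or> A = {0..}" and inf: "Minf \<in> I" "I \<subseteq> {Minf, Pinf}"
  shows "idempotent_comm_semiring (max_semiring (Fin ` A \<union> I)) \<and> presburger_property (max_semiring (Fin ` A \<union> I))"
proof -
  interpret extended_int_monoid "max_semiring (Fin ` A \<union> I)" A I
    by unfold_locales (use fin inf in \<open>auto simp: max_semiring_def natural_le_def fun_eq_iff max_def\<close>)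
  show ?thesis
    using idempotent_comm_semiring_max[OF comm_monoid_axioms] inf(1) presburger_property by blast
qed

lemma min_semiring_presburger:
  "idempotent_comm_semiring (min_semiring (Fin ` {0..} \<union> {Pinf})) \<and> presburger_property (min_semiring (Fin ` {0..} \<union> {Pinf}))"
proof -
  \<comment> \<open>\<open>min x y = y\<close> means \<open>y \<le> x\<close>, so the natural order
    is the reversed one.\<close>
  interpret extended_int_monoid "min_semiring (Fin ` {0..} \<union> {Pinf})" "{0..}" "{Pinf}"
    by unfold_locales (auto simp: min_semiring_def natural_le_def fun_eq_iff min_def)
  show ?thesis
    using idempotent_comm_semiring_min[OF comm_monoid_axioms] presburger_property by blast
qed

theorem theorem2p4:
  fixes S :: "int extended ring"
  assumes "S \<in> {Z_max, Zbar_max, N_max, Nbar_max, N_min}"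
  shows "idempotent_comm_semiring S \<and> presburger_property S"
  using assms max_semiring_presburger[of UNIV "{Minf}"] max_semiring_presburger[of UNIV "{Minf, Pinf}"]
    max_semiring_presburger[of "{0..}" "{Minf}"] max_semiring_presburger[of "{0..}" "{Minf, Pinf}"] min_semiring_presburger
  unfolding Z_max_def Zbar_max_def N_max_def Nbar_max_def N_min_def by auto

end
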